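(* Let $N\ge2$ and $\alpha=(\alpha_0,\alpha_2,\dots,\alpha_{N-1})\in\mathbb{C}^{N-1}$ with $\alpha_0\neq0$. (i) If $W\in Gr_A(\alpha)$, then $\psi_{b_1W}(x,z)$ is a wave function corresponding to a plane $b_1W\in Gr_A(\alpha)$. (ii) The spectral algebra $\mathcal{A}_{V_\alpha}$ of the Airy plane $V_\alpha$ is $\mathbb{C}[L_\alpha]$.
   Context: **Wave functions.** A wave function is a formal series $\Psi_W(x,z)=e^{xz}\bigl(1+\sum_{k\ge1}a_k(x)z^{-k}\bigr)$, with $a_k$ analytic near some base point $x_0$; it corresponds to a plane $W$ of Sato's Grassmannian (with admissible basis $\partial_x^k\Psi_W|_{x=x_0}$). The choice of base point is inessential, and planes and wave functions are identified. The spectral algebra $\mathcal{A}_W$ is the algebra of all differential operators $L_f(x,\partial_x)$ with $L_f\Psi_W=f(z)\Psi_W$ for some polynomial $f(z)$. $W$ is a Darboux transformation of $V$ if there are monic polynomials $f,g$ and differential operators $P,Q$ in $x$ with $\Psi_W=\frac1{g(z)}P\Psi_V$, $\Psi_V=\frac1{f(z)}Q\Psi_W$. **Airy planes.** $L_\alpha=\partial_x^N+\sum_{i=2}^{N-1}\alpha_i\partial_x^{N-i}-\alpha_0x$; fix $\mu_0$ with $\mu_0^N=\alpha_0$. The equation $L_\alpha\Phi=0$ has a unique formal solution $\Psi_\alpha(x)=x^{d/N}e^{Q(x^{1/N})}(1+\sum_{i\ge1}a_ix^{-i/N})$ with $d\in\mathbb{C}$ and $Q$ a polynomial ($Q(0)=0$)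 with leading term $\mu_0\frac N{N+1}x^{N+1}$. Put $\Psi_\alpha(x,z)=\Psi_\alpha(\alpha_0^{-1}z^N+x)$ (expanded in powers of $x$ using $(\alpha_0^{-1}z^N+x)^{-i/N}=\sum_{k\ge0}\binom{-i/N}{k}(\mu_0^{-1}z)^{-i-kN}x^k$). The Airy wave function is $\psi_\alpha(x,z)=\mu_0^dz^{-d}e^{-Q(\mu_0^{-1}z)}\Psi_\alpha(x,z)$, with plane $V_\alpha$. **Involution $b_1$ and $Gr_A(\alpha)$.** For a Darboux transformation $W$ of $V_\alpha$, with wave function $\psi_W=\frac1{g(z)}P\psi_\alpha$, define $\Psi_W$ by $\psi_W=\mu_0^dz^{-d}e^{-Q(\mu_0^{-1}z)}\Psi_W$, and put $\Psi_{b_1W}(x,z):=\Psi_W(\alpha_0^{-1}z^N,\mu_0x^{1/N})$, $\psi_{b_1W}:=\mu_0^dz^{-d}e^{-Q(\mu_0^{-1}z)}\Psi_{b_1W}$. Explicitly, when $g(z)=g_1(z^N)$, $$\psi_{b_1W}(x,z)=\mu_0^dz^{-d}e^{-Q(\mu_0^{-1}z)}\,\frac{1}{g_1(\alpha_0x)}\Bigl[P(y,\partial_y)\Psi_\alpha(x+y)\Bigr]_{y=\alpha_0^{-1}z^N}$$ (everything expanded at $z=\infty$). $Gr_A(\alpha)$ is the set of polynomial Darboux transformations of $V_\alpha$, i.e. Darboux transformations $W$ of $V_\alpha$ such that: (1) $P$ has rational coefficients; (2) $g(z)=g_1(z^N)$ with $g_1\in\mathbb{C}[z]$; (3) $\lim_{z\to\infty}e^{-xz}\psi_{b_1W}(x,z)=1$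 formally, i.e. $e^{-xz}\psi_{b_1W}$ is a formal series $1+\sum_{k\ge1}b_k(x)z^{-k}$. *)

theory Defs
  imports "HOL-Complex_Analysis.Complex_Analysis" "HOL-Computational_Algebra.Computational_Algebra"
begin

text \<open>
  Conventions. A Laurent series in the inverse \<open>1/z\<close> of a variable \<open>z\<close> (an expansion at
  \<open>z = \<infinity>\<close>) is an element of type \<open>_ fls\<close> whose indeterminate \<open>fls_X\<close> stands for \<open>1/z\<close>, so
  that \<open>z\<close> itself is \<open>fls_X_inv\<close>.

  A germ at \<open>x\<^sub>0\<close> of an analytic function of \<open>x\<close> is its Taylor series in \<open>x - x\<^sub>0\<close>, an element of
  type \<open>complex fps\<close> with positive radius of convergence.

  A formal function \<open>\<Psi>(x,z) = e\<^sup>x\<^sup>z F(x,z)\<close>, where \<open>F\<close> is a Laurent series in \<open>1/z\<close> with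
  coefficients depending on \<open>x\<close>, is represented near a base point \<open>x\<^sub>0\<close> by \<open>F\<close>, as an element of
  type \<open>complex fps fls\<close>. A plane is identified with its wave function at a base point.

  A differential operator \<open>\<Sum>\<^sub>j p\<^sub>j(x) \<partial>\<^sub>x\<^sup>j\<close> is represented by the polynomial with coefficients
  \<open>p\<^sub>j\<close>, of type \<open>complex fps poly\<close>. This is only a container: the product of operators is
  \<open>op_comp\<close>, not the product of polynomials.
\<close>

section \<open>Formal series\<close>

definition map_fls :: "('a::zero \<Rightarrow> 'b::zero) \<Rightarrow> 'a fls \<Rightarrow> 'b fls" where
  "map_fls h F = Abs_fls (\<lambda>n. h (fls_nth F n))"

text \<open>A polynomial, expanded at infinity.\<close>

definition at_inf :: "complex poly \<Rightarrow> complex fls" where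
  "at_inf f = poly (map_poly fls_const f) fls_X_inv"

text \<open>A Laurent series in \<open>1/z\<close> that does not depend on \<open>x\<close>.\<close>

definition zser :: "complex fls \<Rightarrow> complex fps fls" where
  "zser = map_fls fps_const"

definition germ :: "complex \<Rightarrow> complex poly \<Rightarrow> complex fps" where
  "germ x0 p = fps_of_poly (p \<circ>\<^sub>p [:x0, 1:])"

section \<open>Wave functions and differential operators\<close>

text \<open>\<open>F = 1 + \<Sum>\<^sub>k\<^sub>\<ge>\<^sub>1 a\<^sub>k(x) z\<^sup>-\<^sup>k\<close>\<close>

definition normalized :: "complex fps fls \<Rightarrow> bool" where
  "normalized F \<longleftrightarrow> (\<forall>n<0. fls_nth F n = 0) \<and> fls_nth F 0 = 1"

definition wave_function :: "complex fps fls \<Rightarrow> bool" where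
  "wave_function F \<longleftrightarrow> normalized F \<and> (\<forall>n. fps_conv_radius (fls_nth F n) > 0)"

text \<open>\<open>\<partial>\<^sub>x (e\<^sup>x\<^sup>z F) = e\<^sup>x\<^sup>z (z F + \<partial>\<^sub>x F)\<close>\<close>

definition dx :: "complex fps fls \<Rightarrow> complex fps fls" where
  "dx F = fls_X_inv * F + map_fls fps_deriv F"

definition analytic_op :: "complex fps poly \<Rightarrow> bool" where
  "analytic_op P \<longleftrightarrow> (\<forall>j. fps_conv_radius (coeff P j) > 0)"

definition op_apply :: "complex fps poly \<Rightarrow> complex fps fls \<Rightarrow> complex fps fls" where
  "op_apply P F = (\<Sum>j\<le>degree P. fls_const (coeff P j) * (dx ^^ j) F)"

text \<open>\<open>\<partial> \<circ> (\<Sum>\<^sub>j q\<^sub>j \<partial>\<^sup>j) = \<Sum>\<^sub>j q\<^sub>j \<partial>\<^sup>j\<^sup>+\<^sup>1 + \<Sum>\<^sub>j q\<^sub>j' \<partial>\<^sup>j\<close>\<close>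

definition op_dcomp :: "complex fps poly \<Rightarrow> complex fps poly" where
  "op_dcomp Q = pCons 0 Q + map_poly fps_deriv Q"

definition op_comp :: "complex fps poly \<Rightarrow> complex fps poly \<Rightarrow> complex fps poly" where
  "op_comp P Q = (\<Sum>j\<le>degree P. smult (coeff P j) ((op_dcomp ^^ j) Q))"

text \<open>The algebra \<open>\<complex>[L]\<close> generated by a differential operator \<open>L\<close>.\<close>

definition op_algebra :: "complex fps poly \<Rightarrow> complex fps poly set" where
  "op_algebra L =
     range (\<lambda>c :: complex poly. \<Sum>k\<le>degree c. smult (fps_const (coeff c k)) ((op_comp L ^^ k) 1))"

definition spectral_algebra :: "complex fps fls \<Rightarrow> complex fps poly set" where
  "spectral_algebra W =
     {L. analytic_op L \<and> (\<exists>f :: complex poly. op_apply L W = zser (at_inf f) * W)}"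

text \<open>\<open>W\<close> is a Darboux transformation of \<open>V\<close>, with the given \<open>g\<close> and \<open>P\<close>.\<close>

definition darboux_via ::
  "complex poly \<Rightarrow> complex fps poly \<Rightarrow> complex fps fls \<Rightarrow> complex fps fls \<Rightarrow> bool" where
  "darboux_via g P V W \<longleftrightarrow>
     lead_coeff g = 1 \<and> analytic_op P \<and> W = zser (1 / at_inf g) * op_apply P V \<and>
     (\<exists>f Q. lead_coeff f = 1 \<and> analytic_op Q \<and> V = zser (1 / at_inf f) * op_apply Q W)"

section \<open>Airy planes\<close>

text \<open>The operator \<open>L\<^sub>\<alpha>\<close> near \<open>x\<^sub>0\<close>. Only \<open>\<alpha> 0\<close> and \<open>\<alpha> 2, \<dots>, \<alpha> (N - 1)\<close> are used.\<close>

definition airy_op :: "nat \<Rightarrow> (nat \<Rightarrow> complex) \<Rightarrow> complex \<Rightarrow> complex fps poly" where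
  "airy_op N \<alpha> x0 =
     monom 1 N + (\<Sum>i=2..N-1. monom (fps_const (\<alpha> i)) (N - i)) - [:germ x0 [:0, \<alpha> 0:]:]"

text \<open>
  With \<open>t = x\<^sup>1\<^sup>/\<^sup>N\<close>, a formal function \<open>t\<^sup>d e\<^sup>Q\<^sup>(\<^sup>t\<^sup>) S\<close> is represented by the Laurent series \<open>S\<close>
  in \<open>u = 1/t\<close>. Since \<open>d/dx = 1/N t\<^sup>1\<^sup>-\<^sup>N d/dt\<close> and \<open>d/dt = - u\<^sup>2 d/du\<close>, its \<open>x\<close>-derivative is
  represented by the following series.
\<close>

definition root_deriv :: "nat \<Rightarrow> complex \<Rightarrow> complex poly \<Rightarrow> complex fls \<Rightarrow> complex fls" where
  "root_deriv N d Q S =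
     fls_const (1 / of_nat N) * fls_X ^ (N - 1) *
       (- (fls_X ^ 2 * fls_deriv S) + (at_inf (pderiv Q) + fls_const d * fls_X) * S)"

text \<open>
  \<open>\<Psi>\<^sub>\<alpha>(x) = x\<^sup>d\<^sup>/\<^sup>N e\<^sup>Q (1 + \<Sum>\<^sub>i\<^sub>\<ge>\<^sub>1 a\<^sub>i x\<^sup>-\<^sup>i\<^sup>/\<^sup>N)\<close>, with \<open>Q\<close> evaluated at \<open>x\<^sup>1\<^sup>/\<^sup>N\<close>, solves
  \<open>L\<^sub>\<alpha> \<Psi>\<^sub>\<alpha> = 0\<close>; note that \<open>x = u\<^sup>-\<^sup>N\<close>.
\<close>

definition airy_solution ::
  "nat \<Rightarrow> (nat \<Rightarrow> complex) \<Rightarrow> complex \<Rightarrow> complex \<Rightarrow> complex poly \<Rightarrow> complex fps \<Rightarrow> bool" where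
  "airy_solution N \<alpha> \<mu> d Q a \<longleftrightarrow>
     degree Q = N + 1 \<and> lead_coeff Q = \<mu> * of_nat N / of_nat (N + 1) \<and> poly Q 0 = 0 \<and>
     fps_nth a 0 = 1 \<and>
     (let D = root_deriv N d Q; S = fps_to_fls a in
        (D ^^ N) S + (\<Sum>i=2..N-1. fls_const (\<alpha> i) * (D ^^ (N - i)) S)
          - fls_const (\<alpha> 0) * fls_X_inv ^ N * S = 0)"

text \<open>
  The substitution \<open>x \<mapsto> \<alpha>\<^sub>0\<^sup>-\<^sup>1 z\<^sup>N + x\<close>, expanded in powers of \<open>x\<close>, takes place in power series in
  \<open>x\<close> whose coefficients are Laurent series in \<open>1/z\<close> (type \<open>complex fls fps\<close>). Write
  \<open>\<zeta> = \<mu>\<^sub>0\<^sup>-\<^sup>1 z\<close>, so \<open>\<zeta>\<^sup>N = \<alpha>\<^sub>0\<^sup>-\<^sup>1 z\<^sup>N\<close>.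
\<close>

definition zeta :: "complex \<Rightarrow> complex fls" where
  "zeta \<mu> = fls_const (1 / \<mu>) * fls_X_inv"

text \<open>\<open>\<zeta>\<^sup>-\<^sup>s (\<zeta>\<^sup>N + x)\<^sup>s\<^sup>/\<^sup>N = \<Sum>\<^sub>k binom(s/N, k) \<zeta>\<^sup>-\<^sup>k\<^sup>N x\<^sup>k\<close>, for any complex \<open>s\<close>\<close>

definition shifted_power :: "nat \<Rightarrow> complex \<Rightarrow> complex \<Rightarrow> complex fls fps" where
  "shifted_power N \<mu> s =
     Abs_fps (\<lambda>k. fls_const ((s / of_nat N) gchoose k) * zeta \<mu> powi (- int (k * N)))"

text \<open>\<open>Q((\<zeta>\<^sup>N + x)\<^sup>1\<^sup>/\<^sup>N) - Q(\<zeta>)\<close>; its constant term in \<open>x\<close> vanishes.\<close>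

definition shifted_exponent :: "nat \<Rightarrow> complex \<Rightarrow> complex poly \<Rightarrow> complex fls fps" where
  "shifted_exponent N \<mu> Q =
     (\<Sum>j\<le>degree Q. fps_const (fls_const (coeff Q j) * zeta \<mu> ^ j) *
        (shifted_power N \<mu> (of_nat j) - 1))"

text \<open>
  \<open>\<Sum>\<^sub>i a\<^sub>i (\<zeta>\<^sup>N + x)\<^sup>-\<^sup>i\<^sup>/\<^sup>N\<close>: the coefficient of \<open>x\<^sup>k\<close> is
  \<open>\<Sum>\<^sub>i a\<^sub>i binom(-i/N, k) \<zeta>\<^sup>-\<^sup>i\<^sup>-\<^sup>k\<^sup>N\<close>, where \<open>\<zeta>\<^sup>-\<^sup>i = \<mu>\<^sub>0\<^sup>i z\<^sup>-\<^sup>i\<close>.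
\<close>

definition shifted_series :: "nat \<Rightarrow> complex \<Rightarrow> complex fps \<Rightarrow> complex fls fps" where
  "shifted_series N \<mu> a =
     Abs_fps (\<lambda>k. fps_to_fls (Abs_fps (\<lambda>i. fps_nth a i * ((- of_nat i / of_nat N) gchoose k) * \<mu> ^ i))
                    * zeta \<mu> powi (- int (k * N)))"

text \<open>
  \<open>\<psi>\<^sub>\<alpha>(x,z) = \<zeta>\<^sup>-\<^sup>d e\<^sup>-\<^sup>Q\<^sup>(\<^sup>\<zeta>\<^sup>) \<Psi>\<^sub>\<alpha>(\<zeta>\<^sup>N + x)\<close>; the prefactor \<open>\<mu>\<^sub>0\<^sup>d z\<^sup>-\<^sup>d\<close> is \<open>\<zeta>\<^sup>-\<^sup>d\<close>.
\<close>

definition airy_psi :: "nat \<Rightarrow> complex \<Rightarrow> complex \<Rightarrow> complex poly \<Rightarrow> complex fps \<Rightarrow> complex fls fps" where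
  "airy_psi N \<mu> d Q a =
     shifted_power N \<mu> d * (fps_exp 1 oo shifted_exponent N \<mu> Q) * shifted_series N \<mu> a"

text \<open>
  The coefficient of \<open>z\<^sup>-\<^sup>n\<close> in \<open>e\<^sup>-\<^sup>x\<^sup>z \<psi>\<^sub>\<alpha>\<close>, as a function of \<open>x\<close>. It is a polynomial, so the sum of
  its power series at \<open>0\<close> is defined everywhere.
\<close>

definition airy_coeff ::
  "nat \<Rightarrow> complex \<Rightarrow> complex \<Rightarrow> complex poly \<Rightarrow> complex fps \<Rightarrow> int \<Rightarrow> complex \<Rightarrow> complex" where
  "airy_coeff N \<mu> d Q a n =
     eval_fps (Abs_fps (\<lambda>k. fls_nth (fps_nth (fps_exp (- fls_X_inv) * airy_psi N \<mu> d Q a) k) n))"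

definition airy_wave ::
  "nat \<Rightarrow> complex \<Rightarrow> complex \<Rightarrow> complex poly \<Rightarrow> complex fps \<Rightarrow> complex \<Rightarrow> complex fps fls" where
  "airy_wave N \<mu> d Q a x0 = Abs_fls (\<lambda>n. fps_expansion (airy_coeff N \<mu> d Q a n) x0)"

section \<open>The involution and polynomial Darboux transformations\<close>

text \<open>
  In this section a differential operator with rational coefficients is given by a common
  denominator \<open>q\<close> and its numerators: \<open>P = \<Sum>\<^sub>j p\<^sub>j(x)/q(x) \<partial>\<^sub>x\<^sup>j\<close> with \<open>p\<^sub>j = coeff p j\<close>.
  Its germ at \<open>x\<^sub>0\<close>, if there is one:
\<close>

definition rational_op_germ ::
  "complex \<Rightarrow> complex poly poly \<Rightarrow> complex poly \<Rightarrow> complex fps poly \<Rightarrow> bool" where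
  "rational_op_germ x0 p q P \<longleftrightarrow>
     q \<noteq> 0 \<and> analytic_op P \<and> (\<forall>j. coeff P j * germ x0 q = germ x0 (coeff p j))"

text \<open>
  The explicit formula for \<open>\<psi>\<^bsub>b\<^sub>1W\<^esub>\<close> near \<open>x\<^sub>1\<close> when \<open>g(z) = g\<^sub>1(z\<^sup>N)\<close>, for \<open>g\<^sub>1(\<alpha>\<^sub>0 x\<^sub>1) \<noteq> 0\<close>. Since
  \<open>\<partial>\<^sub>y\<^sup>j \<Psi>\<^sub>\<alpha>(x + y) = \<partial>\<^sub>x\<^sup>j \<Psi>\<^sub>\<alpha>(x + y)\<close>, the \<open>y\<close>-derivatives at \<open>y = \<alpha>\<^sub>0\<^sup>-\<^sup>1 z\<^sup>N\<close>, times the prefactor,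
  are the \<open>x\<close>-derivatives of \<open>\<psi>\<^sub>\<alpha>(x,z)\<close>.
\<close>

definition b1_wave ::
  "nat \<Rightarrow> (nat \<Rightarrow> complex) \<Rightarrow> complex \<Rightarrow> complex \<Rightarrow> complex poly \<Rightarrow> complex fps \<Rightarrow>
   complex poly poly \<Rightarrow> complex poly \<Rightarrow> complex poly \<Rightarrow> complex \<Rightarrow> complex fps fls" where
  "b1_wave N \<alpha> \<mu> d Q a p q g1 x1 =
     (let y = monom (1 / \<alpha> 0) N in
      fls_const (inverse (germ x1 (g1 \<circ>\<^sub>p [:0, \<alpha> 0:]))) *
      (\<Sum>j\<le>degree p. zser (at_inf (coeff p j \<circ>\<^sub>p y) / at_inf (q \<circ>\<^sub>p y)) *
                      (dx ^^ j) (airy_wave N \<mu> d Q a x1)))"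

text \<open>
  \<open>W\<close>, near \<open>x\<^sub>0\<close>, is a Darboux transformation of \<open>V\<^sub>\<alpha>\<close> with \<open>g(z) = g\<^sub>1(z\<^sup>N)\<close> and \<open>P\<close> the rational
  operator given by \<open>p\<close>, \<open>q\<close>.
\<close>

definition airy_darboux ::
  "nat \<Rightarrow> complex \<Rightarrow> complex \<Rightarrow> complex poly \<Rightarrow> complex fps \<Rightarrow>
   complex poly poly \<Rightarrow> complex poly \<Rightarrow> complex poly \<Rightarrow> complex \<Rightarrow> complex fps fls \<Rightarrow> bool" where
  "airy_darboux N \<mu> d Q a p q g1 x0 W \<longleftrightarrow>
     wave_function W \<and>
     (\<exists>P. rational_op_germ x0 p q P \<and>
          darboux_via (g1 \<circ>\<^sub>p monom 1 N) P (airy_wave N \<mu> d Q a x0) W)"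

text \<open>\<open>Gr\<^sub>A(\<alpha>)\<close>: the wave functions, near \<open>x\<^sub>0\<close>, of its planes.\<close>

definition Gr_A ::
  "nat \<Rightarrow> (nat \<Rightarrow> complex) \<Rightarrow> complex \<Rightarrow> complex \<Rightarrow> complex poly \<Rightarrow> complex fps \<Rightarrow>
   complex \<Rightarrow> complex fps fls set" where
  "Gr_A N \<alpha> \<mu> d Q a x0 =
     {W. \<exists>p q g1. airy_darboux N \<mu> d Q a p q g1 x0 W \<and>
           (\<forall>x1. poly g1 (\<alpha> 0 * x1) \<noteq> 0 \<longrightarrow> normalized (b1_wave N \<alpha> \<mu> d Q a p q g1 x1))}"

end

theory Submission
  imports Defs
begin

text \<open>
  The Taylor expansion \<open>f(x) \<mapsto> f(\<zeta>\<^sup>N + x)\<close> commutes with \<open>d/dx\<close>, so the equation for \<open>\<Psi>\<^sub>\<alpha>\<close> becomes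
  \<open>L\<^sub>\<alpha> \<psi>\<^sub>\<alpha> = z\<^sup>N \<psi>\<^sub>\<alpha>\<close>. Since an operator is determined by its action on \<open>\<psi>\<^sub>\<alpha>\<close>, identities between formal
  functions \<open>P \<psi>\<^sub>\<alpha>\<close> can be checked between operators.

  The Weyl algebra has an involutive anti-automorphism \<open>b\<close> with \<open>b(\<partial>) = \<partial>\<close> and \<open>b(x) = L\<^sub>\<alpha>/\<alpha>\<^sub>0\<close>, hence
  \<open>b(L\<^sub>\<alpha>) = \<alpha>\<^sub>0 x\<close>. An operator commuting with \<open>L\<^sub>\<alpha>\<close> has polynomial coefficients (compare symbols, order by
  order), so its image under \<open>b\<close> commutes with \<open>x\<close> and is a polynomial in \<open>x\<close>; this gives (ii). For
  \<open>W = g\<^sub>1(z\<^sup>N)\<^sup>-\<^sup>1 q(x)\<^sup>-\<^sup>1 p(x,\<partial>) \<psi>\<^sub>\<alpha>\<close> one gets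
  \<open>\<psi>\<^bsub>b\<^sub>1W\<^esub> = g\<^sub>1(\<alpha>\<^sub>0 x)\<^sup>-\<^sup>1 q(z\<^sup>N/\<alpha>\<^sub>0)\<^sup>-\<^sup>1 b(p) \<psi>\<^sub>\<alpha>\<close>, which is a Darboux transformation of \<open>V\<^sub>\<alpha>\<close> as soon as \<open>b(p)\<close>
  is a right factor of a polynomial in \<open>L\<^sub>\<alpha>\<close>. By (ii), \<open>p\<close> is a right factor of some \<open>r(x) h(L\<^sub>\<alpha>)\<close>; apply \<open>b\<close> and
  use the Ore condition for \<open>\<complex>[L\<^sub>\<alpha>]\<close>.
\<close>

section \<open>Differential operators over a differential ring\<close>

text \<open>Left multiplication by \<open>\<partial>\<close> over any coefficient ring: polynomials,
  where the anti-automorphism lives, as well as germs, where the instance is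
  \<open>op_dcomp\<close>.\<close>

definition dcomp :: "('a::comm_ring_1 \<Rightarrow> 'a) \<Rightarrow> 'a poly \<Rightarrow> 'a poly" where
  "dcomp D A = pCons 0 A + map_poly D A"

definition ocomp :: "('a::comm_ring_1 \<Rightarrow> 'a) \<Rightarrow> 'a poly \<Rightarrow> 'a poly \<Rightarrow> 'a poly" where
  "ocomp D A B = (\<Sum>j\<le>degree A. smult (coeff A j) ((dcomp D ^^ j) B))"

lemma smult_sum_right: "smult c (sum F I) = (\<Sum>i\<in>I. smult c (F i))"
  by (induction I rule: infinite_finite_induct) (simp_all add: smult_add_right)

text \<open>\<open>S\<close> holds the admissible coefficients, so that convergence of germs can be
  carried through products and divisions.\<close>

locale derivation =
  fixes D :: "'a::idom \<Rightarrow> 'a" and S :: "'a set"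
  assumes D_add: "D (f + g) = D f + D g"
    and D_mult: "D (f * g) = f * D g + D f * g"
    and S_1: "1 \<in> S"
    and S_diff: "f \<in> S \<Longrightarrow> g \<in> S \<Longrightarrow> f - g \<in> S"
    and S_mult: "f \<in> S \<Longrightarrow> g \<in> S \<Longrightarrow> f * g \<in> S"
    and S_D: "f \<in> S \<Longrightarrow> D f \<in> S"
begin

abbreviation opprod :: "'a poly \<Rightarrow> 'a poly \<Rightarrow> 'a poly" (infixl "\<odot>" 70) where
  "A \<odot> B \<equiv> ocomp D A B"

abbreviation d :: "'a poly \<Rightarrow> 'a poly" where
  "d \<equiv> dcomp D"

lemma D_0 [simp]: "D 0 = 0"
  using D_add[of 0 0] by (metis add_0 add_cancel_right_right)

lemma D_1 [simp]: "D 1 = 0"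
  using D_mult[of 1 1] by (metis add_cancel_right_right mult_1 mult_1_right)

lemma coeff_dcomp: "coeff (d A) n = (case n of 0 \<Rightarrow> 0 | Suc m \<Rightarrow> coeff A m) + D (coeff A n)"
  by (simp add: dcomp_def coeff_pCons coeff_map_poly)

lemma dcomp_add: "d (A + B) = d A + d B"
  by (rule poly_eqI) (simp add: coeff_dcomp D_add split: nat.splits)

lemma dcomp_0 [simp]: "d 0 = 0"
  by (simp add: dcomp_def)

lemma dcomp_minus: "d (- A) = - d A"
  using dcomp_add[of A "- A"] by (simp add: eq_neg_iff_add_eq_0 add.commute)

lemma dcomp_smult: "d (smult f A) = smult f (d A) + smult (D f) A"
  by (rule poly_eqI) (simp add: coeff_dcomp D_mult algebra_simps split: nat.splits)

lemma dcomp_sum: "d (sum F I) = (\<Sum>i\<in>I. d (F i))"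
  by (induction I rule: infinite_finite_induct) (simp_all add: dcomp_add)

lemma dcomp_const: "d [:f:] = [:D f, f:]"
  by (rule poly_eqI) (auto simp: coeff_dcomp coeff_pCons split: nat.splits)

lemma dcomp_pow_add: "(d ^^ n) (A + B) = (d ^^ n) A + (d ^^ n) B"
  by (induction n) (simp_all add: dcomp_add)

lemma dcomp_pow_0 [simp]: "(d ^^ n) 0 = 0"
  by (induction n) simp_all

lemma dcomp_pow_minus: "(d ^^ n) (- A) = - (d ^^ n) A"
  by (induction n) (simp_all add: dcomp_minus)

lemma dcomp_pow_smult_const: "D c = 0 \<Longrightarrow> (d ^^ n) (smult c A) = smult c ((d ^^ n) A)"
  by (induction n) (simp_all add: dcomp_smult)

lemma dcomp_pow_1: "(d ^^ n) 1 = monom 1 n"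
proof (induction n)
  case (Suc n)
  then show ?case
    by (auto intro!: poly_eqI simp: coeff_dcomp split: nat.splits)
qed simp

lemma ocomp_bound:
  assumes "degree A \<le> n"
  shows "A \<odot> B = (\<Sum>j\<le>n. smult (coeff A j) ((d ^^ j) B))"
  unfolding ocomp_def using assms
  by (intro sum.mono_neutral_left) (auto simp: coeff_eq_0)

lemma ocomp_add_left: "(A + B) \<odot> C = A \<odot> C + B \<odot> C"
proof -
  define n where "n = max (degree A) (degree B)"
  have "degree A \<le> n" "degree B \<le> n" "degree (A + B) \<le> n"
    by (auto simp: n_def degree_add_le)
  then show ?thesis
    by (simp add: ocomp_bound[of _ n] smult_add_left sum.distrib)
qed

lemma ocomp_smult_left: "smult f A \<odot> B = smult f (A \<odot> B)"
proof -
  have "degree (smult f A) \<le> degree A" by (rule degree_smult_le)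
  then show ?thesis
    by (simp add: ocomp_bound[of "smult f A" "degree A"] ocomp_bound[of A "degree A"] smult_sum_right)
qed

lemma ocomp_0_left [simp]: "0 \<odot> B = 0"
  by (simp add: ocomp_def)

lemma ocomp_minus_left: "(- A) \<odot> B = - (A \<odot> B)"
  using ocomp_smult_left[of "-1" A B] by simp

lemma ocomp_diff_left: "(A - B) \<odot> C = A \<odot> C - B \<odot> C"
  using ocomp_add_left[of A "- B" C] by (simp add: ocomp_minus_left)

lemma ocomp_sum_left: "sum F I \<odot> B = (\<Sum>i\<in>I. F i \<odot> B)"
  by (induction I rule: infinite_finite_induct) (simp_all add: ocomp_add_left)

lemma ocomp_add_right: "A \<odot> (B + C) = A \<odot> B + A \<odot> C"
  by (simp add: ocomp_def dcomp_pow_add smult_add_right sum.distrib)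

lemma ocomp_0_right [simp]: "A \<odot> 0 = 0"
  by (simp add: ocomp_def)

lemma ocomp_minus_right: "A \<odot> (- B) = - (A \<odot> B)"
  by (simp add: ocomp_def dcomp_pow_minus sum_negf)

lemma ocomp_diff_right: "A \<odot> (B - C) = A \<odot> B - A \<odot> C"
  using ocomp_add_right[of A B "- C"] by (simp add: ocomp_minus_right)

lemma ocomp_sum_right: "A \<odot> sum F I = (\<Sum>i\<in>I. A \<odot> F i)"
  by (induction I rule: infinite_finite_induct) (simp_all add: ocomp_add_right)

lemma ocomp_smult_right_const: "D c = 0 \<Longrightarrow> A \<odot> smult c B = smult c (A \<odot> B)"
  by (simp add: ocomp_def dcomp_pow_smult_const smult_sum_right mult.commute)

lemma ocomp_const_left [simp]: "[:f:] \<odot> B = smult f B"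
  by (simp add: ocomp_def)

lemma ocomp_1_left [simp]: "1 \<odot> B = B"
  by (simp add: ocomp_def)

lemma ocomp_monom: "monom f n \<odot> B = smult f ((d ^^ n) B)"
proof -
  have "monom f n \<odot> B = (\<Sum>j\<le>n. smult (coeff (monom f n) j) ((d ^^ j) B))"
    by (rule ocomp_bound) (rule degree_monom_le)
  also have "\<dots> = (\<Sum>j\<le>n. if j = n then smult f ((d ^^ n) B) else 0)"
    by (rule sum.cong) auto
  finally show ?thesis by simp
qed

lemma ocomp_1_right [simp]: "A \<odot> 1 = A"
  by (simp add: ocomp_def dcomp_pow_1 smult_monom poly_as_sum_of_monoms)

lemma ocomp_pCons_0: "pCons 0 A \<odot> B = A \<odot> d B"
proof -
  have "pCons 0 A \<odot> B = (\<Sum>j\<le>Suc (degree A). smult (coeff (pCons 0 A) j) ((d ^^ j) B))"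
    by (rule ocomp_bound) (simp add: degree_pCons_le)
  then show ?thesis
    by (simp add: sum.atMost_Suc_shift ocomp_def funpow_swap1 del: sum.atMost_Suc)
qed

lemma ocomp_map_D: "map_poly D A \<odot> B = (\<Sum>j\<le>degree A. smult (D (coeff A j)) ((d ^^ j) B))"
proof -
  have "degree (map_poly D A) \<le> degree A"
    by (rule degree_le) (simp add: coeff_map_poly coeff_eq_0)
  then show ?thesis
    by (simp add: ocomp_bound[of _ "degree A"] coeff_map_poly)
qed

text \<open>Associativity for the left factor \<open>\<partial>\<close>; iterating it and expanding
  \<open>A\<close> in powers of \<open>\<partial>\<close> gives \<open>ocomp_assoc\<close>.\<close>

lemma dcomp_ocomp: "d A \<odot> B = d (A \<odot> B)"
proof -
  have "d A \<odot> B = A \<odot> d B + map_poly D A \<odot> B"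
    by (simp add: dcomp_def[of D A] ocomp_add_left ocomp_pCons_0)
  also have "\<dots> = d (A \<odot> B)"
    by (simp add: ocomp_map_D ocomp_def[of D A B] ocomp_def[of D A "d B"] dcomp_sum dcomp_smult
        sum.distrib funpow_swap1)
  finally show ?thesis .
qed

lemma dcomp_pow_ocomp: "(d ^^ n) A \<odot> B = (d ^^ n) (A \<odot> B)"
  by (induction n) (simp_all add: dcomp_ocomp)

lemma ocomp_assoc: "(A \<odot> B) \<odot> C = A \<odot> (B \<odot> C)"
  by (simp add: ocomp_def[of D A] ocomp_sum_left ocomp_smult_left dcomp_pow_ocomp)

lemma dcomp_eq: "d A = monom 1 (Suc 0) \<odot> A"
  by (simp add: ocomp_monom)

lemma ocomp_monom_right: "A \<odot> monom 1 (Suc 0) = pCons 0 A"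
  using ocomp_pCons_0[of A 1] dcomp_pow_1[of "Suc 0"] by simp

section \<open>Leading coefficients of products and commutators\<close>

lemma coeff_dcomp_pow_top:
  assumes "degree A \<le> n"
  shows "degree ((d ^^ k) A) \<le> k + n" and "coeff ((d ^^ k) A) (k + n) = coeff A n"
proof (induction k)
  case (Suc k)
  {
    case 1
    show ?case
    proof (rule degree_le, intro allI impI)
      fix i assume i: "Suc k + n < i"
      then obtain l where "i = Suc l" by (cases i) auto
      with i have "k + n < l" "k + n < i" by auto
      with Suc show "coeff ((d ^^ Suc k) A) i = 0"
        using \<open>i = Suc l\<close> by (simp add: coeff_dcomp coeff_eq_0)
    qed
  next
    case 2
    from Suc have "coeff ((d ^^ k) A) (Suc (k + n)) = 0"
      by (simp add: coeff_eq_0)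
    with Suc show ?case by (simp add: coeff_dcomp)
  }
qed (use assms in auto)

lemma coeff_ocomp_top:
  assumes "degree A \<le> m" "degree B \<le> n"
  shows "degree (A \<odot> B) \<le> m + n" and "coeff (A \<odot> B) (m + n) = coeff A m * coeff B n"
proof -
  have AB: "A \<odot> B = (\<Sum>j\<le>m. smult (coeff A j) ((d ^^ j) B))"
    using assms(1) by (rule ocomp_bound)
  have deg: "degree ((d ^^ j) B) \<le> j + n" for j
    by (rule coeff_dcomp_pow_top) fact
  show "degree (A \<odot> B) \<le> m + n"
    unfolding AB
    by (rule degree_sum_le) (auto intro: order.trans[OF degree_smult_le] order.trans[OF deg])
  have "coeff (A \<odot> B) (m + n) = (\<Sum>j\<le>m. coeff A j * coeff ((d ^^ j) B) (m + n))"
    by (simp add: AB coeff_sum)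
  also have "\<dots> = (\<Sum>j\<le>m. if j = m then coeff A m * coeff B n else 0)"
  proof (rule sum.cong)
    fix j assume "j \<in> {..m}"
    then show "coeff A j * coeff ((d ^^ j) B) (m + n) = (if j = m then coeff A m * coeff B n else 0)"
      using deg[of j] coeff_dcomp_pow_top(2)[OF assms(2), of m]
      by (auto simp: coeff_eq_0)
  qed simp
  finally show "coeff (A \<odot> B) (m + n) = coeff A m * coeff B n"
    by simp
qed

lemma ocomp_eq_0_iff: "A \<odot> B = 0 \<longleftrightarrow> A = 0 \<or> B = 0"
proof -
  have "A \<odot> B \<noteq> 0" if "A \<noteq> 0" "B \<noteq> 0"
    using coeff_ocomp_top(2)[of A "degree A" B "degree B"] that by auto
  then show ?thesis by auto
qed

lemma degree_ocomp:
  assumes "A \<noteq> 0" "B \<noteq> 0"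
  shows "degree (A \<odot> B) = degree A + degree B"
  using coeff_ocomp_top[of A "degree A" B "degree B"] assms
  by (metis leading_coeff_0_iff le_antisym le_degree mult_eq_0_iff order_refl)

text \<open>Leibniz rule to second order: each of the \<open>Suc k\<close> derivations may hit the
  leading coefficient once, while the coefficient one order lower passes through.\<close>

lemma coeff_dcomp_pow_second:
  assumes "degree A \<le> m"
  shows "coeff ((d ^^ Suc k) A) (k + m) =
    (case m of 0 \<Rightarrow> 0 | Suc l \<Rightarrow> coeff A l) + of_nat (Suc k) * D (coeff A m)"
proof (induction k)
  case 0
  show ?case by (simp add: coeff_dcomp)
next
  case (Suc k)
  have "coeff ((d ^^ Suc (Suc k)) A) (Suc k + m) =
      coeff ((d ^^ Suc k) A) (k + m) + D (coeff ((d ^^ Suc k) A) (Suc k + m))"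
    by (simp only: funpow.simps comp_apply coeff_dcomp) simp
  also have "\<dots> = (case m of 0 \<Rightarrow> 0 | Suc l \<Rightarrow> coeff A l) + of_nat (Suc (Suc k)) * D (coeff A m)"
    using Suc coeff_dcomp_pow_top(2)[OF assms, of "Suc k"] by (simp add: algebra_simps)
  finally show ?case .
qed

lemma ocomp_monom_1_right: "A \<odot> monom 1 n = monom 1 n * A"
proof (induction n)
  case (Suc n)
  have "A \<odot> monom 1 (Suc n) = A \<odot> (monom 1 n \<odot> monom 1 (Suc 0))"
    by (simp only: ocomp_monom_right monom_Suc[of _ n])
  also have "\<dots> = pCons 0 (A \<odot> monom 1 n)"
    unfolding ocomp_assoc[symmetric] by (rule ocomp_monom_right)
  finally show ?case using Suc by (simp add: monom_Suc)
qed (simp add: monom_0 one_pCons[symmetric])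

text \<open>Because of the gap of two orders below \<open>\<partial>^n\<close>, the products with
  \<open>R\<close> stay below order \<open>n + m - 1\<close>. The lower coefficient of
  \<open>A\<close> cancels between the two products with \<open>\<partial>^n\<close>, and the
  Leibniz term remains.\<close>

lemma coeff_commutator:
  assumes "degree A \<le> m" "degree R + 2 \<le> n"
  shows "coeff ((monom 1 n + R) \<odot> A - A \<odot> (monom 1 n + R)) (n + m - 1) = of_nat n * D (coeff A m)"
proof -
  obtain k where n: "n = Suc k" using assms(2) by (cases n) auto
  have "degree (R \<odot> A) \<le> degree R + m" "degree (A \<odot> R) \<le> m + degree R"
    using coeff_ocomp_top(1) assms(1) by blast+
  then have "coeff (R \<odot> A) (n + m - 1) = 0" "coeff (A \<odot> R) (n + m - 1) = 0"
    using assms(2) by (auto intro!: coeff_eq_0)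
  moreover have "coeff (monom 1 n \<odot> A) (n + m - 1) =
      (case m of 0 \<Rightarrow> 0 | Suc l \<Rightarrow> coeff A l) + of_nat n * D (coeff A m)"
    using coeff_dcomp_pow_second[OF assms(1), of k] by (simp add: ocomp_monom n)
  moreover have "coeff (A \<odot> monom 1 n) (n + m - 1) = (case m of 0 \<Rightarrow> 0 | Suc l \<Rightarrow> coeff A l)"
    by (auto simp: ocomp_monom_1_right coeff_monom_mult n split: nat.splits)
  ultimately show ?thesis
    by (simp add: ocomp_add_left ocomp_add_right)
qed

section \<open>Admissible coefficients and pseudo-division\<close>

definition over_S :: "'a poly \<Rightarrow> bool" where
  "over_S A \<longleftrightarrow> (\<forall>j. coeff A j \<in> S)"

lemma S_0: "0 \<in> S"
  using S_diff[OF S_1 S_1] by simp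

lemma S_minus: "f \<in> S \<Longrightarrow> - f \<in> S"
  using S_diff[OF S_0] by force

lemma S_add: "f \<in> S \<Longrightarrow> g \<in> S \<Longrightarrow> f + g \<in> S"
  using S_diff[of f "- g"] S_minus by force

lemma over_S_add: "over_S A \<Longrightarrow> over_S B \<Longrightarrow> over_S (A + B)"
  by (simp add: over_S_def S_add)

lemma over_S_diff: "over_S A \<Longrightarrow> over_S B \<Longrightarrow> over_S (A - B)"
  by (simp add: over_S_def S_diff)

lemma over_S_0: "over_S 0"
  by (simp add: over_S_def S_0)

lemma over_S_sum: "(\<And>i. i \<in> I \<Longrightarrow> over_S (F i)) \<Longrightarrow> over_S (sum F I)"
  by (induction I rule: infinite_finite_induct) (simp_all add: over_S_0 over_S_add)

lemma over_S_smult: "f \<in> S \<Longrightarrow> over_S A \<Longrightarrow> over_S (smult f A)"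
  by (simp add: over_S_def S_mult)

lemma over_S_monom: "f \<in> S \<Longrightarrow> over_S (monom f n)"
  by (simp add: over_S_def S_0)

lemma over_S_dcomp_pow: "over_S A \<Longrightarrow> over_S ((d ^^ n) A)"
  by (induction n) (auto simp: over_S_def coeff_dcomp S_D S_0 S_add split: nat.splits)

lemma over_S_ocomp: "over_S A \<Longrightarrow> over_S B \<Longrightarrow> over_S (A \<odot> B)"
  unfolding ocomp_def
  by (intro over_S_sum over_S_smult over_S_dcomp_pow) (simp_all add: over_S_def)

text \<open>The coefficients form only a domain, so each division step costs a factor
  \<open>lead_coeff P\<close>. Bounding the remainder by vanishing coefficients rather than by
  \<open>degree\<close> also covers a divisor of order 0, where it forces
  \<open>R = 0\<close>.\<close>

lemma ocomp_pseudo_div: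
  assumes "P \<noteq> 0"
  obtains k Q R where "smult (lead_coeff P ^ k) H = Q \<odot> P + R"
    "\<And>j. j \<ge> degree P \<Longrightarrow> coeff R j = 0"
    "over_S P \<Longrightarrow> over_S H \<Longrightarrow> over_S Q"
proof -
  define m where "m = degree P"
  define l where "l = lead_coeff P"
  have "\<exists>k Q R. smult (l ^ k) H = Q \<odot> P + R \<and> (\<forall>j\<ge>m. coeff R j = 0) \<and>
      (over_S P \<longrightarrow> over_S H \<longrightarrow> over_S Q)" if "degree H < n" for n
    using that
  proof (induction n arbitrary: H)
    case (Suc n)
    show ?case
    proof (cases "n < m")
      case True
      with Suc.prems have "\<forall>j\<ge>m. coeff H j = 0"
        by (auto intro!: coeff_eq_0)
      then have "smult (l ^ 0) H = 0 \<odot> P + H \<and> (\<forall>j\<ge>m. coeff H j = 0) \<and>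
          (over_S P \<longrightarrow> over_S H \<longrightarrow> over_S 0)"
        by (simp add: over_S_0)
      then show ?thesis by blast
    next
      case False
      \<comment> \<open>\<open>M P\<close> and \<open>l H\<close> have the same coefficient of order
        \<open>n\<close>, so \<open>H'\<close> loses that order at the cost of one factor
        \<open>l\<close>.\<close>
      define M where "M = monom (coeff H n) (n - m)"
      define H' where "H' = smult l H - M \<odot> P"
      have M: "degree M \<le> n - m" unfolding M_def by (rule degree_monom_le)
      have "degree (M \<odot> P) \<le> n" "coeff (M \<odot> P) n = coeff H n * l"
        using coeff_ocomp_top[OF M, of P m] False by (auto simp: m_def l_def M_def)
      moreover have "degree (smult l H) \<le> n"
        using Suc.prems by (intro order.trans[OF degree_smult_le]) auto
      ultimately have H': "degree H' \<le> n" "coeff H' n = 0"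
        unfolding H'_def by (auto intro: degree_diff_le)
      have over: "over_S H' \<and> over_S M" if "over_S P" "over_S H"
        unfolding H'_def M_def using that
        by (intro conjI over_S_diff over_S_smult over_S_ocomp over_S_monom)
          (auto simp: over_S_def l_def)
      show ?thesis
      proof (cases "degree H' < n")
        case True
        from Suc.IH[OF this] obtain k Q R where *: "smult (l ^ k) H' = Q \<odot> P + R"
          "\<forall>j\<ge>m. coeff R j = 0" "over_S P \<longrightarrow> over_S H' \<longrightarrow> over_S Q" by blast
        have "smult (l ^ Suc k) H = smult (l ^ k) H' + smult (l ^ k) (M \<odot> P)"
          by (simp add: H'_def smult_diff_right mult.commute)
        also have "\<dots> = (Q + smult (l ^ k) M) \<odot> P + R"
          by (simp add: * ocomp_add_left ocomp_smult_left)
        finally have "smult (l ^ Suc k) H = (Q + smult (l ^ k) M) \<odot> P + R" .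
        moreover have "over_S (Q + smult (l ^ k) M)" if "over_S P" "over_S H"
        proof -
          have "l \<in> S" using that by (simp add: over_S_def l_def)
          then have "l ^ k \<in> S" by (induction k) (simp_all add: S_1 S_mult)
          with over[OF that] * that show ?thesis
            by (auto intro: over_S_add over_S_smult)
        qed
        ultimately show ?thesis using *(2) by blast
      next
        case False
        \<comment> \<open>The strict bound can fail only at \<open>n = 0\<close>, where a vanishing
          leading coefficient means \<open>H' = 0\<close>.\<close>
        with H' have "H' = 0"
          by (metis leading_coeff_0_iff le_antisym not_less)
        then have "smult (l ^ 1) H = M \<odot> P + 0 \<and> (\<forall>j\<ge>m. coeff 0 j = 0) \<and>
          (over_S P \<longrightarrow> over_S H \<longrightarrow> over_S M)"
          using over by (simp add: H'_def)
        then show ?thesis by blast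
      qed
    qed
  qed simp
  from this[of "Suc (degree H)"] show ?thesis
    unfolding m_def l_def using that by auto
qed

end

section \<open>Operators with polynomial coefficients and their germs\<close>

interpretation W: derivation "pderiv :: complex poly \<Rightarrow> _" UNIV
  by unfold_locales (simp_all add: pderiv_add pderiv_mult mult.commute)

interpretation F: derivation "fps_deriv :: complex fps \<Rightarrow> _" "{f. fps_conv_radius f > 0}"
proof
  fix f g :: "complex fps"
  assume fg: "f \<in> {f. fps_conv_radius f > 0}" "g \<in> {f. fps_conv_radius f > 0}"
  then show "f - g \<in> {f. fps_conv_radius f > 0}" "f * g \<in> {f. fps_conv_radius f > 0}"
    by (auto intro: less_le_trans[OF _ fps_conv_radius_diff] less_le_trans[OF _ fps_conv_radius_mult])
next
  fix f :: "complex fps"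
  assume "f \<in> {f. fps_conv_radius f > 0}"
  then show "fps_deriv f \<in> {f. fps_conv_radius f > 0}"
    by (auto intro: less_le_trans[OF _ fps_conv_radius_deriv])
qed simp_all

abbreviation wprod :: "complex poly poly \<Rightarrow> complex poly poly \<Rightarrow> complex poly poly" (infixl "\<odot>" 70) where
  "A \<odot> B \<equiv> ocomp pderiv A B"

lemma op_dcomp_eq: "op_dcomp = dcomp fps_deriv"
  by (intro ext) (simp add: op_dcomp_def dcomp_def)

lemma op_comp_eq: "op_comp = ocomp fps_deriv"
  by (intro ext) (simp add: op_comp_def ocomp_def op_dcomp_eq)

lemma analytic_op_eq: "analytic_op = F.over_S"
  by (intro ext) (simp add: analytic_op_def F.over_S_def)

lemma germ_0 [simp]: "germ x 0 = 0"
  and germ_const [simp]: "germ x [:c:] = fps_const c"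
  and germ_add: "germ x (p + q) = germ x p + germ x q"
  and germ_diff: "germ x (p - q) = germ x p - germ x q"
  and germ_minus: "germ x (- p) = - germ x p"
  and germ_mult: "germ x (p * q) = germ x p * germ x q"
  and germ_smult: "germ x (smult c p) = fps_const c * germ x p"
  by (simp_all add: germ_def fps_of_poly_simps pcompose_add pcompose_diff pcompose_mult
      pcompose_uminus pcompose_smult)

lemma germ_1 [simp]: "germ x 1 = 1"
  using germ_const[of x 1] by (simp add: one_pCons[symmetric] del: germ_const)

lemma germ_sum: "germ x (sum F I) = (\<Sum>i\<in>I. germ x (F i))"
  by (induction I rule: infinite_finite_induct) (simp_all add: germ_add)

lemma germ_eq_0_iff [simp]: "germ x p = 0 \<longleftrightarrow> p = 0"
  by (auto simp: germ_def fps_of_poly_eq_iff[of _ 0, simplified] dest: pcompose_eq_0)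

lemma germ_eq_iff: "germ x p = germ x q \<longleftrightarrow> p = q"
  using germ_eq_0_iff[of x "p - q"] by (simp add: germ_diff del: germ_eq_0_iff)

lemma fps_deriv_germ: "fps_deriv (germ x p) = germ x (pderiv p)"
  by (simp add: germ_def fps_of_poly_pderiv[symmetric] pderiv_pcompose pderiv_pCons)

lemma fps_conv_radius_germ [simp]: "fps_conv_radius (germ x p) = \<infinity>"
  by (simp add: germ_def)

lemma germ_nth_0: "fps_nth (germ x p) 0 = poly p x"
  by (simp add: germ_def coeff_pcompose_0)

abbreviation op_germ :: "complex \<Rightarrow> complex poly poly \<Rightarrow> complex fps poly" where
  "op_germ x \<equiv> map_poly (germ x)"

lemma op_germ_add: "op_germ x (A + B) = op_germ x A + op_germ x B"
  by (rule poly_eqI) (simp add: coeff_map_poly germ_add)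

lemma op_germ_diff: "op_germ x (A - B) = op_germ x A - op_germ x B"
  by (rule poly_eqI) (simp add: coeff_map_poly germ_diff)

lemma op_germ_smult: "op_germ x (smult f A) = smult (germ x f) (op_germ x A)"
  by (rule poly_eqI) (simp add: coeff_map_poly germ_mult)

lemma op_germ_sum: "op_germ x (sum F I) = (\<Sum>i\<in>I. op_germ x (F i))"
  by (induction I rule: infinite_finite_induct) (simp_all add: op_germ_add)

lemma op_germ_monom: "op_germ x (monom f n) = monom (germ x f) n"
  by (rule map_poly_monom) simp

lemma op_germ_eq_iff: "op_germ x A = op_germ x B \<longleftrightarrow> A = B"
  by (simp add: poly_eq_iff coeff_map_poly germ_eq_iff)

lemma degree_op_germ [simp]: "degree (op_germ x A) = degree A"
  by (rule degree_map_poly) simp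

lemma op_germ_dcomp: "op_germ x (dcomp pderiv A) = dcomp fps_deriv (op_germ x A)"
  by (rule poly_eqI)
    (simp add: coeff_map_poly W.coeff_dcomp F.coeff_dcomp germ_add fps_deriv_germ split: nat.splits)

lemma op_germ_ocomp: "op_germ x (A \<odot> B) = ocomp fps_deriv (op_germ x A) (op_germ x B)"
proof -
  have "op_germ x ((dcomp pderiv ^^ j) B) = (dcomp fps_deriv ^^ j) (op_germ x B)" for j
    by (induction j) (simp_all add: op_germ_dcomp)
  then show ?thesis
    by (simp add: ocomp_def op_germ_sum op_germ_smult coeff_map_poly)
qed

lemma analytic_op_germ: "analytic_op (op_germ x A)"
  by (simp add: analytic_op_def coeff_map_poly)

section \<open>Polynomials in an operator\<close>

definition oeval :: "complex poly \<Rightarrow> complex poly poly \<Rightarrow> complex poly poly" where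
  "oeval f A = (\<Sum>k\<le>degree f. smult [:coeff f k:] ((ocomp pderiv A ^^ k) 1))"

lemma oeval_0 [simp]: "oeval 0 A = 0"
  by (simp add: oeval_def)

lemma pderiv_const_poly [simp]: "pderiv [:c:] = 0"
  by (simp add: pderiv_pCons)

lemma oeval_pCons: "oeval (pCons c f) A = [:[:c:]:] + A \<odot> oeval f A"
proof -
  have "oeval (pCons c f) A =
      (\<Sum>k\<le>Suc (degree f). smult [:coeff (pCons c f) k:] ((ocomp pderiv A ^^ k) 1))"
    by (auto simp: oeval_def)
  also have "\<dots> = [:[:c:]:] + (\<Sum>k\<le>degree f. smult [:coeff f k:] (A \<odot> (ocomp pderiv A ^^ k) 1))"
    by (simp add: sum.atMost_Suc_shift del: sum.atMost_Suc)
  finally show ?thesis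
    by (simp add: oeval_def W.ocomp_sum_right W.ocomp_smult_right_const)
qed

lemma oeval_const [simp]: "oeval [:c:] A = [:[:c:]:]"
  by (simp add: oeval_pCons)

lemma oeval_X [simp]: "oeval [:0, 1:] A = A"
  by (simp add: oeval_pCons W.ocomp_1_right[unfolded one_pCons])

lemma oeval_add: "oeval (f + g) A = oeval f A + oeval g A"
  by (induction f g rule: poly_induct2) (simp_all add: oeval_pCons W.ocomp_add_right)

lemma oeval_smult: "oeval (smult c f) A = smult [:c:] (oeval f A)"
  by (induction f)
    (simp_all add: oeval_pCons W.ocomp_smult_right_const smult_add_right)

lemma oeval_mult: "oeval (f * g) A = oeval f A \<odot> oeval g A"
  by (induction f)
    (simp_all add: oeval_pCons oeval_add oeval_smult W.ocomp_add_left W.ocomp_assoc)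

lemma oeval_commute: "oeval f A \<odot> oeval g A = oeval g A \<odot> oeval f A"
  by (metis oeval_mult mult.commute)

lemma oeval_commute_self: "oeval f A \<odot> A = A \<odot> oeval f A"
  using oeval_commute[of f A "[:0, 1:]"] by simp

lemma oeval_function: "oeval h [:f:] = [:h \<circ>\<^sub>p f:]"
  by (induction h) (simp_all add: oeval_pCons pcompose_pCons)

lemma oeval_smult_right: "oeval f (smult [:c:] A) = oeval (f \<circ>\<^sub>p [:0, c:]) A"
proof (induction f)
  case (pCons a f)
  have "pCons a f \<circ>\<^sub>p [:0, c:] = [:a:] + smult c [:0, 1:] * (f \<circ>\<^sub>p [:0, c:])"
    by (simp add: pcompose_pCons)
  then have "oeval (pCons a f \<circ>\<^sub>p [:0, c:]) A =
      [:[:a:]:] + smult [:c:] (A \<odot> oeval (f \<circ>\<^sub>p [:0, c:]) A)"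
    by (simp only: oeval_add oeval_const oeval_mult oeval_smult oeval_X W.ocomp_smult_left)
  then show ?case
    using pCons by (simp add: oeval_pCons W.ocomp_smult_left)
qed simp

lemma op_germ_oeval:
  "op_germ x (oeval c A) =
    (\<Sum>k\<le>degree c. smult (fps_const (coeff c k)) ((op_comp (op_germ x A) ^^ k) 1))"
proof -
  have "op_germ x ((ocomp pderiv A ^^ k) 1) = (op_comp (op_germ x A) ^^ k) 1" for k
    by (induction k) (simp_all add: op_germ_ocomp op_comp_eq)
  then show ?thesis
    by (simp add: oeval_def op_germ_sum op_germ_smult)
qed

text \<open>Since \<open>\<partial> r^(k+1) = r^k (r \<partial> + (k+1) r')\<close>, moving a power
  of \<open>r\<close> to the left past \<open>\<partial>\<close> costs one factor \<open>r\<close>;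
  one more power for each order of \<open>Y\<close> is enough.\<close>

lemma ore_condition:
  fixes Y :: "complex poly poly"
  shows "\<exists>k Z. Y \<odot> [:r ^ k:] = smult r Z"
proof (induction Y)
  case 0
  have "0 \<odot> [:r ^ 0:] = smult r 0" by simp
  then show ?case by blast
next
  case (pCons a Y)
  then obtain k Z where Z: "Y \<odot> [:r ^ k:] = smult r Z" by blast
  have "pderiv (r ^ Suc k) = r ^ k * (of_nat (Suc k) * pderiv r)"
    unfolding pderiv_power_Suc by (simp add: of_nat_poly mult_ac)
  then have deriv: "dcomp pderiv [:r ^ Suc k:] = [:r ^ k:] \<odot> ([:0, r:] + [:of_nat (Suc k) * pderiv r:])"
    by (simp add: W.dcomp_const mult.commute)
  have "pCons a Y \<odot> [:r ^ Suc k:] = [:a:] \<odot> [:r ^ Suc k:] + pCons 0 Y \<odot> [:r ^ Suc k:]"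
    by (simp only: W.ocomp_add_left[symmetric]) simp
  also have "\<dots> = smult r (smult (r ^ k) [:a:]) + (Y \<odot> [:r ^ k:]) \<odot> ([:0, r:] + [:of_nat (Suc k) * pderiv r:])"
    by (simp only: W.ocomp_pCons_0 deriv W.ocomp_assoc) (simp add: mult_ac)
  also have "\<dots> = smult r (smult (r ^ k) [:a:] + Z \<odot> ([:0, r:] + [:of_nat (Suc k) * pderiv r:]))"
    by (simp only: Z W.ocomp_smult_left smult_add_right)
  finally show ?case by blast
qed

section \<open>The bispectral anti-automorphism of the Weyl algebra\<close>

text \<open>The commutator with \<open>x\<close> is differentiation in the symbol
  \<open>\<partial>\<close>: \<open>pderiv\<close> acts here on the outer polynomial
  variable.\<close>

lemma ocomp_linear_right: "B \<odot> [:[:0, c:]:] = smult [:0, c:] B + smult [:c:] (pderiv B)"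
proof (induction B)
  case (pCons a B)
  have deriv: "dcomp pderiv [:[:0, c:]:] = [:[:0, c:]:] \<odot> monom 1 (Suc 0) + [:[:c:]:]"
    by (simp add: W.dcomp_const W.ocomp_monom_right pderiv_pCons smult_monom monom_Suc monom_0)
  have "pCons a B \<odot> [:[:0, c:]:] = [:a * [:0, c:]:] + B \<odot> dcomp pderiv [:[:0, c:]:]"
    using W.ocomp_add_left[of "[:a:]" "pCons 0 B" "[:[:0, c:]:]"] by (simp add: W.ocomp_pCons_0)
  also have "B \<odot> dcomp pderiv [:[:0, c:]:] = pCons 0 (B \<odot> [:[:0, c:]:]) + smult [:c:] B"
  proof -
    have "B \<odot> [:[:c:]:] = smult [:c:] B"
      using W.ocomp_smult_right_const[of "[:c:]" B 1] by simp
    then show ?thesis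
      unfolding deriv W.ocomp_add_right W.ocomp_assoc[symmetric]
      by (simp only: W.ocomp_monom_right)
  qed
  finally show ?case
    by (simp add: pCons pderiv_pCons smult_add_right mult.commute)
qed simp

locale airy_weyl =
  fixes N :: nat and \<alpha> :: "nat \<Rightarrow> complex"
  assumes N_ge_2: "N \<ge> 2" and \<alpha>_0: "\<alpha> 0 \<noteq> 0"
begin

definition L_low :: "complex poly poly" where
  "L_low = (\<Sum>i=2..N-1. monom [:\<alpha> i:] (N - i)) - [:[:0, \<alpha> 0:]:]"

definition L :: "complex poly poly" where
  "L = monom 1 N + L_low"

text \<open>The image of \<open>x\<close> under the anti-automorphism \<open>b\<close>.\<close>

definition X :: "complex poly poly" where
  "X = smult [:1 / \<alpha> 0:] L"

text \<open>On generators it fixes \<open>\<partial>\<close> and sends \<open>x\<close> to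
  \<open>X\<close>; placing \<open>\<partial>^j\<close> on the left is what makes it reverse
  products.\<close>

definition b :: "complex poly poly \<Rightarrow> complex poly poly" where
  "b P = (\<Sum>j\<le>degree P. (dcomp pderiv ^^ j) (oeval (coeff P j) X))"

lemma dcomp_monom: "dcomp pderiv (monom [:c:] n) = monom [:c:] n \<odot> monom 1 (Suc 0)"
  by (simp add: dcomp_def W.ocomp_monom_right map_poly_monom)

lemma dcomp_L: "dcomp pderiv L = L \<odot> monom 1 (Suc 0) - [:[:\<alpha> 0:]:]"
proof -
  have 1: "dcomp pderiv (monom 1 N) = monom 1 N \<odot> monom 1 (Suc 0)"
    using dcomp_monom[of 1 N] by (simp add: one_pCons[symmetric])
  have 2: "dcomp pderiv (- [:[:0, \<alpha> 0:]:]) = (- [:[:0, \<alpha> 0:]:]) \<odot> monom 1 (Suc 0) - [:[:\<alpha> 0:]:]"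
    by (simp add: W.dcomp_const W.dcomp_minus pderiv_pCons W.ocomp_minus_left smult_monom monom_Suc monom_0)
  have "L = monom 1 N + (\<Sum>i=2..N-1. monom [:\<alpha> i:] (N - i)) + (- [:[:0, \<alpha> 0:]:])"
    by (simp add: L_def L_low_def)
  then show ?thesis
    by (simp only: W.dcomp_add W.dcomp_sum 1 2 dcomp_monom W.ocomp_add_left W.ocomp_sum_left) simp
qed

text \<open>Only the term \<open>- \<alpha> 0 * x\<close> of \<open>L\<close> fails to commute with
  \<open>\<partial>\<close>. The resulting \<open>[\<partial>, X] = -1\<close> is the reversed Weyl
  relation that \<open>b\<close> has to respect.\<close>

lemma dcomp_X: "dcomp pderiv X = X \<odot> monom 1 (Suc 0) - 1"
  by (simp add: X_def W.dcomp_smult W.ocomp_smult_left dcomp_L smult_diff_right \<alpha>_0 one_pCons)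

lemma dcomp_oeval_X: "dcomp pderiv (oeval f X) + oeval (pderiv f) X = oeval f X \<odot> monom 1 (Suc 0)"
proof (induction f)
  case (pCons c f)
  have "dcomp pderiv (oeval (pCons c f) X) =
      [:[:c:]:] \<odot> monom 1 (Suc 0) + (X \<odot> monom 1 (Suc 0) - 1) \<odot> oeval f X"
    by (simp add: oeval_pCons W.dcomp_add W.dcomp_ocomp[symmetric] dcomp_X)
      (simp add: W.dcomp_const smult_monom monom_Suc monom_0)
  also have "\<dots> = [:[:c:]:] \<odot> monom 1 (Suc 0) + X \<odot> dcomp pderiv (oeval f X) - oeval f X"
    by (simp add: W.ocomp_diff_left W.ocomp_assoc W.dcomp_eq[symmetric])
  finally show ?case using pCons(2)
    by (simp add: oeval_pCons pderiv_pCons oeval_add W.ocomp_add_left W.ocomp_assoc pCons(2)[symmetric]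
        W.ocomp_add_right)
qed simp

lemma b_0 [simp]: "b 0 = 0"
  by (simp add: b_def)

lemma b_pCons: "b (pCons f P) = oeval f X + dcomp pderiv (b P)"
proof -
  have "b (pCons f P) = (\<Sum>j\<le>Suc (degree P). (dcomp pderiv ^^ j) (oeval (coeff (pCons f P) j) X))"
    by (auto simp: b_def)
  also have "\<dots> = oeval f X + (\<Sum>j\<le>degree P. (dcomp pderiv ^^ Suc j) (oeval (coeff P j) X))"
    by (simp add: sum.atMost_Suc_shift del: sum.atMost_Suc)
  finally show ?thesis by (simp add: b_def W.dcomp_sum)
qed

lemma b_function [simp]: "b [:f:] = oeval f X"
  by (simp add: b_pCons)

lemma b_1 [simp]: "b 1 = 1"
  using b_function[of 1] by (simp add: one_pCons del: b_function)

lemma b_add: "b (P + R) = b P + b R"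
  by (induction P R rule: poly_induct2) (simp_all add: b_pCons oeval_add W.dcomp_add)

lemma b_minus: "b (- P) = - b P"
  using b_add[of P "- P"] by (simp add: eq_neg_iff_add_eq_0 add.commute)

lemma b_sum: "b (sum F I) = (\<Sum>i\<in>I. b (F i))"
  by (induction I rule: infinite_finite_induct) (simp_all add: b_add)

lemma b_smult: "b (smult f P) = b P \<odot> oeval f X"
proof (induction P)
  case (pCons g P)
  then show ?case
    by (simp add: b_pCons oeval_mult oeval_commute[of f] W.ocomp_add_left W.dcomp_ocomp)
qed simp

lemma b_smult_const: "b (smult [:c:] P) = smult [:c:] (b P)"
  by (simp add: b_smult) (metis W.ocomp_1_right W.ocomp_smult_right_const one_pCons
      pderiv_const_poly smult_pCons smult_0_right mult.right_neutral)

lemma b_dcomp: "b (dcomp pderiv P) = b P \<odot> monom 1 (Suc 0)"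
proof (induction P)
  case (pCons g P)
  have "dcomp pderiv (pCons g P) = pCons (pderiv g) (dcomp pderiv P + [:g:])"
    by (rule poly_eqI) (auto simp: W.coeff_dcomp coeff_pCons split: nat.splits)
  then have "b (dcomp pderiv (pCons g P)) =
      oeval (pderiv g) X + dcomp pderiv (b P \<odot> monom 1 (Suc 0) + oeval g X)"
    by (simp add: b_pCons[of "pderiv g"] b_add pCons)
  then show ?case
    by (simp add: b_pCons W.ocomp_add_left W.dcomp_ocomp W.dcomp_add dcomp_oeval_X[symmetric])
qed simp

text \<open>Left multiplication by a function (\<open>b_smult\<close>) and by
  \<open>\<partial>\<close> (\<open>b_dcomp\<close>) is already reversed; induction on
  \<open>A\<close> combines the two.\<close>

lemma b_ocomp: "b (A \<odot> B) = b B \<odot> b A"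
proof (induction A arbitrary: B)
  case (pCons f A)
  have "pCons f A \<odot> B = smult f B + A \<odot> dcomp pderiv B"
    using W.ocomp_add_left[of "[:f:]" "pCons 0 A" B] by (simp add: W.ocomp_pCons_0)
  then show ?case
    by (simp add: b_add b_smult pCons b_dcomp b_pCons W.ocomp_add_right W.ocomp_assoc W.dcomp_eq[of "b A"])
qed simp

lemma b_monom: "b (monom 1 n) = monom 1 n"
  by (induction n) (simp_all add: monom_Suc monom_0 one_pCons[symmetric] b_pCons W.dcomp_pow_1
      dcomp_def map_poly_monom)

lemma b_L: "b L = [:[:0, \<alpha> 0:]:]"
proof -
  have "b (monom [:c:] n) = monom [:c:] n" for c n
    using b_smult_const[of c "monom 1 n"] by (simp add: smult_monom b_monom)
  moreover have "b (- [:[:0, \<alpha> 0:]:]) = - L"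
  proof -
    have "b [:[:0, \<alpha> 0:]:] = oeval (smult (\<alpha> 0) [:0, 1:]) X" by simp
    also have "\<dots> = L" unfolding oeval_smult oeval_X by (simp add: X_def \<alpha>_0 one_pCons[symmetric])
    finally show ?thesis by (simp only: b_minus)
  qed
  moreover have "L = monom 1 N + (\<Sum>i=2..N-1. monom [:\<alpha> i:] (N - i)) + (- [:[:0, \<alpha> 0:]:])"
    by (simp add: L_def L_low_def)
  \<comment> \<open>The constant-coefficient part \<open>L + \<alpha> 0 * x\<close> is fixed and
    \<open>- \<alpha> 0 * x\<close> goes to \<open>- L\<close>, so \<open>\<alpha> 0 * x\<close>
    remains.\<close>
  ultimately show ?thesis
    by (metis (no_types, lifting) b_add b_monom b_sum sum.cong add_diff_cancel_left' diff_conv_add_uminus minus_diff_eq add.inverse_inverse)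
qed

lemma b_X: "b X = [:[:0, 1:]:]"
  by (simp add: X_def b_smult_const b_L \<alpha>_0)

lemma b_oeval: "b (oeval f A) = oeval f (b A)"
  by (induction f) (simp_all add: oeval_pCons b_add b_ocomp oeval_commute_self)

lemma b_b [simp]: "b (b P) = P"
proof (induction P)
  case (pCons f P)
  then show ?case
    by (simp add: b_pCons b_add b_oeval b_X oeval_function b_dcomp W.ocomp_monom_right)
qed simp

lemma b_eq_0_iff [simp]: "b P = 0 \<longleftrightarrow> P = 0"
  by (metis b_0 b_b)

text \<open>Under \<open>b\<close>, commuting with \<open>L\<close> becomes commuting with
  \<open>x\<close>. The derivative of \<open>b A\<close> in the symbol \<open>\<partial>\<close>
  then vanishes, so \<open>b A\<close> is a function \<open>f\<close> and
  \<open>A = f(X)\<close>.\<close>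

lemma commutes_with_L_imp:
  assumes "A \<odot> L = L \<odot> A"
  obtains c where "A = oeval c L"
proof -
  have comm: "[:[:0, \<alpha> 0:]:] \<odot> b A = b A \<odot> [:[:0, \<alpha> 0:]:]"
    using arg_cong[OF assms, of b] by (simp add: b_ocomp b_L)
  then have "pderiv (b A) = 0"
    by (simp add: ocomp_linear_right \<alpha>_0)
  then have "degree (b A) = 0"
    by (simp add: pderiv_eq_0_iff)
  then obtain f where "b A = [:f:]" by (rule degree_eq_zeroE)
  then have "A = oeval f X" by (metis b_b b_function)
  then show ?thesis using that by (simp add: X_def oeval_smult_right)
qed

end

section \<open>The commutant of the Airy operator\<close>

lemma poly_antiderivative: "\<exists>q. pderiv q = (p :: complex poly)"
proof -
  define q where "q = (\<Sum>i\<le>degree p. monom (coeff p i / of_nat (Suc i)) (Suc i))"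
  have "pderiv q = (\<Sum>i\<le>degree p. monom (coeff p i) i)"
    unfolding q_def
    using higher_pderiv_sum[of 1 "\<lambda>i. monom (coeff p i / of_nat (Suc i)) (Suc i)" "{..degree p}"]
    by (simp add: pderiv_monom del: of_nat_Suc)
  then show ?thesis by (metis poly_as_sum_of_monoms)
qed

lemma germ_antiderivative:
  assumes "fps_deriv f = germ x p"
  obtains q where "f = germ x q"
proof -
  obtain q where "pderiv q = p" using poly_antiderivative by blast
  then have "fps_deriv (f - germ x q) = 0"
    using assms by (simp add: fps_deriv_germ)
  then have "f - germ x q = germ x [:fps_nth (f - germ x q) 0:]"
    by (simp only: germ_const fps_deriv_eq_0_iff)
  then have "f = germ x ([:fps_nth (f - germ x q) 0:] + q)"
    by (simp only: germ_add) (simp add: diff_eq_eq)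
  then show ?thesis by (rule that)
qed

context airy_weyl
begin

lemma degree_L_low: "degree L_low + 2 \<le> N"
proof -
  have "degree L_low \<le> N - 2"
    unfolding L_low_def
    by (intro degree_diff_le degree_sum_le order.trans[OF degree_monom_le]) auto
  then show ?thesis using N_ge_2 by simp
qed

lemma op_germ_L: "op_germ x L = monom 1 N + op_germ x L_low"
  by (simp add: L_def op_germ_add op_germ_monom)

text \<open>The coefficient of order \<open>N + m - 1\<close> is \<open>N\<close> times the
  derivative of the leading coefficient of \<open>A\<close>, which is therefore an antiderivative of
  a polynomial. Removing this top term changes the commutator by a polynomial operator; hence an
  arbitrary \<open>C\<close> instead of 0.\<close>

lemma polynomial_commutator_imp:
  assumes "ocomp fps_deriv (op_germ x L) A - ocomp fps_deriv A (op_germ x L) = op_germ x C"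
  shows "\<exists>B. A = op_germ x B"
  using assms
proof (induction "degree A" arbitrary: A C rule: less_induct)
  case less
  define m where "m = degree A"
  have "of_nat N * fps_deriv (coeff A m) = germ x (coeff C (N + m - 1))"
    using F.coeff_commutator[of A m "op_germ x L_low" N] degree_L_low
      arg_cong[OF less.prems, of "\<lambda>B. coeff B (N + m - 1)"]
    by (simp add: m_def op_germ_L coeff_map_poly)
  then have "germ x (smult (1 / of_nat N) (coeff C (N + m - 1))) =
      fps_const (1 / of_nat N * of_nat N) * fps_deriv (coeff A m)"
    by (simp only: germ_smult fps_const_mult[symmetric] fps_of_nat mult.assoc)
  then have "fps_deriv (coeff A m) = germ x (smult (1 / of_nat N) (coeff C (N + m - 1)))"
    using N_ge_2 by simp
  then obtain q where q: "coeff A m = germ x q" by (rule germ_antiderivative)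
  define A' where "A' = A - op_germ x (monom q m)"
  have A: "A = A' + op_germ x (monom q m)" by (simp add: A'_def)
  have "\<exists>B. A' = op_germ x B"
  proof (cases "m = 0")
    case True
    then obtain f where "A = [:f:]" unfolding m_def by (rule degree_eq_zeroE)
    with True q have "A' = op_germ x 0"
      by (simp add: A'_def monom_0 map_poly_pCons)
    then show ?thesis by blast
  next
    case False
    have "degree A' \<le> m"
      unfolding A'_def by (intro degree_diff_le) (simp_all add: m_def degree_monom_le)
    moreover have "coeff A' m = 0" by (simp add: A'_def op_germ_monom q)
    ultimately have "degree A' < m"
      using False by (metis degree_0 le_neq_implies_less leading_coeff_0_iff not_gr_zero)
    moreover have "ocomp fps_deriv (op_germ x L) A' - ocomp fps_deriv A' (op_germ x L) =
        op_germ x (C - (L \<odot> monom q m - monom q m \<odot> L))"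
      using less.prems by (simp add: A'_def F.ocomp_diff_left F.ocomp_diff_right op_germ_diff op_germ_ocomp)
    ultimately show ?thesis using less.hyps m_def by blast
  qed
  then show ?case by (metis A op_germ_add)
qed

lemma commutant_of_L:
  assumes "ocomp fps_deriv A (op_germ x L) = ocomp fps_deriv (op_germ x L) A"
  obtains c where "A = op_germ x (oeval c L)"
proof -
  have "ocomp fps_deriv (op_germ x L) A - ocomp fps_deriv A (op_germ x L) = op_germ x 0"
    using assms by simp
  then obtain B where B: "A = op_germ x B" using polynomial_commutator_imp by blast
  with assms have "B \<odot> L = L \<odot> B"
    by (metis op_germ_eq_iff op_germ_ocomp)
  then show ?thesis using that B by (metis commutes_with_L_imp)
qed

end

section \<open>The action of differential operators on formal functions\<close>

text \<open>Free lower bounds, in place of subdegrees, give the same range of summation to series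
  whose subdegrees may differ, such as a series and its coefficientwise derivative.\<close>

lemma fls_times_nth_bounds:
  fixes f g :: "'a::idom fls"
  assumes f: "\<And>i. i < m \<Longrightarrow> fls_nth f i = 0" and g: "\<And>i. i < n \<Longrightarrow> fls_nth g i = 0"
  shows "fls_nth (f * g) k = (\<Sum>i=m..k-n. fls_nth f i * fls_nth g (k - i))"
proof (cases "f = 0 \<or> g = 0")
  case False
  have "m \<le> fls_subdegree f"
    by (rule ccontr) (use False f[of "fls_subdegree f"] in auto)
  moreover have "n \<le> fls_subdegree g"
    by (rule ccontr) (use False g[of "fls_subdegree g"] in auto)
  ultimately show ?thesis
    unfolding fls_times_nth(2)
    by (intro sum.mono_neutral_left) auto
qed auto

lemma fls_lower_bound: "\<exists>m. \<forall>i<m. fls_nth f i = 0"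
  using fls_eq0_below_subdegree by blast

lemma map_fls_nth: "h 0 = 0 \<Longrightarrow> fls_nth (map_fls h F) n = h (fls_nth F n)"
  unfolding map_fls_def
  by (rule nth_Abs_fls) (rule eventually_mono[OF MOST_fls_neg_nth_eq_0[of F]], simp)

lemma zser_nth [simp]: "fls_nth (zser c) n = fps_const (fls_nth c n)"
  by (simp add: zser_def map_fls_nth)

lemma fps_const_sum: "fps_const (sum f I) = (\<Sum>i\<in>I. fps_const (f i))"
  by (rule fps_ext) (simp add: fps_sum_nth)

lemma zser_mult: "zser (c * e) = zser c * zser e"
proof (rule fls_eqI)
  fix k
  obtain m where m: "\<And>i. i < m \<Longrightarrow> fls_nth c i = 0" using fls_lower_bound[of "c"] by blast
  obtain n where n: "\<And>i. i < n \<Longrightarrow> fls_nth e i = 0" using fls_lower_bound[of "e"] by blast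
  have "fls_nth (zser c * zser e) k = (\<Sum>i=m..k-n. fls_nth (zser c) i * fls_nth (zser e) (k - i))"
    by (rule fls_times_nth_bounds) (simp_all add: m n)
  also have "\<dots> = fps_const (\<Sum>i=m..k-n. fls_nth c i * fls_nth e (k - i))"
    by (simp add: fps_const_sum)
  finally show "fls_nth (zser (c * e)) k = fls_nth (zser c * zser e) k"
    using fls_times_nth_bounds[of m c n e k] m n by simp
qed

lemma zser_1 [simp]: "zser 1 = 1"
  by (rule fls_eqI) simp

lemma zser_0 [simp]: "zser 0 = 0"
  by (rule fls_eqI) simp

lemma zser_const: "zser (fls_const c) = fls_const (fps_const c)"
  by (rule fls_eqI) simp

lemma zser_add: "zser (c + e) = zser c + zser e"
  by (rule fls_eqI) simp

lemma zser_eq_0_iff [simp]: "zser c = 0 \<longleftrightarrow> c = 0"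
  by (auto simp: fls_eq_iff)

lemma dx_nth: "fls_nth (dx F) n = fls_nth F (n + 1) + fps_deriv (fls_nth F n)"
  by (simp add: dx_def map_fls_nth fls_X_inv_times_conv_shift)

lemma dx_add: "dx (F + G) = dx F + dx G"
  by (rule fls_eqI) (simp add: dx_nth)

lemma dx_0 [simp]: "dx 0 = 0"
  by (rule fls_eqI) (simp add: dx_nth)

lemma dx_const_mult: "dx (fls_const f * F) = fls_const f * dx F + fls_const (fps_deriv f) * F"
  by (rule fls_eqI) (simp add: dx_nth algebra_simps)

text \<open>Series in \<open>z\<close> alone are constants for \<open>d/dx\<close>; hence they
  commute with every operator (\<open>op_apply_zser\<close>).\<close>

lemma dx_zser_mult: "dx (zser c * F) = zser c * dx F"
proof -
  have "map_fls fps_deriv (zser c * F) = zser c * map_fls fps_deriv F"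
  proof (rule fls_eqI)
    fix k
    obtain m where m: "\<And>i. i < m \<Longrightarrow> fls_nth c i = 0" using fls_lower_bound[of "c"] by blast
    obtain n where n: "\<And>i. i < n \<Longrightarrow> fls_nth F i = 0" using fls_lower_bound[of "F"] by blast
    have "fls_nth (zser c * F) k = (\<Sum>i=m..k-n. fls_nth (zser c) i * fls_nth F (k - i))"
      by (rule fls_times_nth_bounds) (simp_all add: m n)
    moreover have "fls_nth (zser c * map_fls fps_deriv F) k =
        (\<Sum>i=m..k-n. fls_nth (zser c) i * fls_nth (map_fls fps_deriv F) (k - i))"
      by (rule fls_times_nth_bounds) (simp_all add: m n map_fls_nth)
    ultimately show "fls_nth (map_fls fps_deriv (zser c * F)) k =
        fls_nth (zser c * map_fls fps_deriv F) k"
      by (simp add: map_fls_nth fps_deriv_sum)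
  qed
  then show ?thesis by (simp add: dx_def algebra_simps)
qed

lemma op_apply_bound:
  assumes "degree A \<le> n"
  shows "op_apply A F = (\<Sum>j\<le>n. fls_const (coeff A j) * (dx ^^ j) F)"
  unfolding op_apply_def using assms
  by (intro sum.mono_neutral_left) (auto simp: coeff_eq_0)

lemma op_apply_0 [simp]: "op_apply 0 F = 0"
  by (simp add: op_apply_def)

lemma op_apply_add: "op_apply (A + B) F = op_apply A F + op_apply B F"
proof -
  define n where "n = max (degree A) (degree B)"
  have "degree A \<le> n" "degree B \<le> n" "degree (A + B) \<le> n"
    by (auto simp: n_def degree_add_le)
  then show ?thesis
    by (simp add: op_apply_bound[of _ n] distrib_right sum.distrib flip: fls_plus_const)
qed

lemma op_apply_smult: "op_apply (smult f A) F = fls_const f * op_apply A F"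
proof -
  have "degree (smult f A) \<le> degree A" by (rule degree_smult_le)
  then show ?thesis
    by (simp add: op_apply_bound[of "smult f A" "degree A"] op_apply_bound[of A "degree A"]
        sum_distrib_left mult.assoc flip: fls_const_mult_const)
qed

lemma op_apply_diff: "op_apply (A - B) F = op_apply A F - op_apply B F"
  using op_apply_add[of "A - B" B F] by simp

lemma op_apply_sum: "op_apply (sum H I) F = (\<Sum>i\<in>I. op_apply (H i) F)"
  by (induction I rule: infinite_finite_induct) (simp_all add: op_apply_add)

lemma op_apply_const [simp]: "op_apply [:f:] F = fls_const f * F"
  by (simp add: op_apply_def)

lemma op_apply_pCons: "op_apply (pCons f A) F = fls_const f * F + op_apply A (dx F)"
proof -
  have "op_apply (pCons f A) F = (\<Sum>j\<le>Suc (degree A). fls_const (coeff (pCons f A) j) * (dx ^^ j) F)"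
    by (rule op_apply_bound) (rule degree_pCons_le)
  then show ?thesis
    by (simp add: sum.atMost_Suc_shift op_apply_def funpow_swap1 del: sum.atMost_Suc)
qed

lemma op_apply_monom: "op_apply (monom f n) F = fls_const f * (dx ^^ n) F"
  by (induction n arbitrary: F) (simp_all add: monom_0 monom_Suc op_apply_pCons funpow_swap1)

lemma op_apply_dcomp: "op_apply (dcomp fps_deriv A) F = dx (op_apply A F)"
proof (induction A arbitrary: F)
  case (pCons f A)
  have "dcomp fps_deriv (pCons f A) = pCons (fps_deriv f) (dcomp fps_deriv A + [:f:])"
    by (rule poly_eqI) (auto simp: F.coeff_dcomp coeff_pCons split: nat.splits)
  then show ?case
    by (simp add: op_apply_pCons op_apply_add pCons.IH dx_add dx_const_mult add_ac)
qed simp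

lemma op_apply_ocomp: "op_apply (ocomp fps_deriv A B) F = op_apply A (op_apply B F)"
proof (induction A arbitrary: B)
  case (pCons f A)
  have "ocomp fps_deriv (pCons f A) B = smult f B + ocomp fps_deriv A (dcomp fps_deriv B)"
    using F.ocomp_add_left[of "[:f:]" "pCons 0 A" B] by (simp add: F.ocomp_pCons_0)
  then show ?case
    by (simp add: op_apply_add op_apply_smult pCons op_apply_pCons op_apply_dcomp)
qed simp

lemma op_apply_zser: "op_apply A (zser c * F) = zser c * op_apply A F"
  by (induction A arbitrary: F) (simp_all add: op_apply_pCons dx_zser_mult distrib_left mult.left_commute)

text \<open>To leading order \<open>\<partial>^j\<close> multiplies \<open>e^(xz) (1 + ...)\<close>
  by \<open>z^j\<close>, whose index is \<open>- int j\<close> because the indeterminate is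
  \<open>1/z\<close>.\<close>

lemma dx_pow_nth_leading:
  assumes "normalized F"
  shows "n < - int j \<Longrightarrow> fls_nth ((dx ^^ j) F) n = 0" and "fls_nth ((dx ^^ j) F) (- int j) = 1"
proof (induction j arbitrary: n)
  case (Suc j)
  {
    case 1
    with Suc show ?case by (simp add: dx_nth)
  next
    case 2
    from Suc(1)[of "- int (Suc j)"] Suc(2) show ?case by (simp add: dx_nth)
  }
qed (use assms in \<open>auto simp: normalized_def\<close>)

lemma op_apply_nth_leading:
  assumes "normalized F" "degree A \<le> m"
  shows "n < - int m \<Longrightarrow> fls_nth (op_apply A F) n = 0"
    and "fls_nth (op_apply A F) (- int m) = coeff A m"
proof -
  have eq: "fls_nth (op_apply A F) n = (\<Sum>j\<le>m. coeff A j * fls_nth ((dx ^^ j) F) n)" for n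
    by (simp add: op_apply_bound[OF assms(2)] fls_nth_sum)
  show "fls_nth (op_apply A F) n = 0" if "n < - int m"
    unfolding eq using that
    by (intro sum.neutral) (auto simp: dx_pow_nth_leading(1)[OF assms(1)])
  have "fls_nth (op_apply A F) (- int m) = (\<Sum>j\<le>m. if j = m then coeff A m else 0)"
    unfolding eq
    by (rule sum.cong) (auto simp: dx_pow_nth_leading[OF assms(1)])
  then show "fls_nth (op_apply A F) (- int m) = coeff A m"
    by simp
qed

text \<open>The top power of \<open>z\<close> carries the leading coefficient of \<open>A\<close>.
  This reduces identities between formal functions to identities between operators.\<close>

lemma op_apply_eq_0_iff:
  assumes "normalized F"
  shows "op_apply A F = 0 \<longleftrightarrow> A = 0"
  using op_apply_nth_leading(2)[OF assms, of A "degree A"] by auto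

section \<open>Polynomials at infinity\<close>

lemma at_inf_0 [simp]: "at_inf 0 = 0"
  by (simp add: at_inf_def)

lemma at_inf_pCons: "at_inf (pCons c f) = fls_const c + fls_X_inv * at_inf f"
  by (simp add: at_inf_def map_poly_pCons)

lemma at_inf_const [simp]: "at_inf [:c:] = fls_const c"
  by (simp add: at_inf_pCons)

lemma at_inf_add: "at_inf (f + g) = at_inf f + at_inf g"
  by (induction f g rule: poly_induct2) (simp_all add: at_inf_pCons distrib_left add_ac flip: fls_plus_const)

lemma at_inf_smult: "at_inf (smult c f) = fls_const c * at_inf f"
  by (induction f) (simp_all add: at_inf_pCons distrib_left mult_ac flip: fls_const_mult_const)

lemma at_inf_mult: "at_inf (f * g) = at_inf f * at_inf g"
  by (induction f) (simp_all add: at_inf_pCons at_inf_add at_inf_smult distrib_right mult.assoc)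

lemma at_inf_nth: "fls_nth (at_inf f) n = (if n \<le> 0 then coeff f (nat (- n)) else 0)"
proof (induction f arbitrary: n)
  case (pCons c f)
  have "nat (- n) = Suc (nat (- (n + 1)))" if "n < 0" using that by simp
  then show ?case
    by (auto simp: at_inf_pCons fls_X_inv_times_conv_shift pCons(2))
qed simp

lemma at_inf_eq_0_iff [simp]: "at_inf f = 0 \<longleftrightarrow> f = 0"
proof
  assume "at_inf f = 0"
  then have "coeff f n = 0" for n
    using at_inf_nth[of f "- int n"] by simp
  then show "f = 0" by (simp add: poly_eq_iff)
qed simp

lemma at_inf_monom: "at_inf (monom c n) = fls_const c * fls_X_inv ^ n"
  by (induction n) (simp_all add: monom_0 monom_Suc at_inf_pCons)

section \<open>Families of formal functions with polynomial coefficients\<close>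

text \<open>One global formal function with polynomial coefficients, seen from every base point; an
  identity of coefficients at one point transfers to all others.\<close>

definition poly_family :: "(complex \<Rightarrow> complex fps fls) \<Rightarrow> (int \<Rightarrow> complex poly) \<Rightarrow> bool" where
  "poly_family F c \<longleftrightarrow> (\<forall>x n. fls_nth (F x) n = germ x (c n))"

lemma poly_family_const_mult: "poly_family F c \<Longrightarrow> poly_family (\<lambda>x. fls_const (germ x p) * F x) (\<lambda>n. p * c n)"
  by (simp add: poly_family_def germ_mult)

lemma poly_family_add:
  "poly_family F c \<Longrightarrow> poly_family G e \<Longrightarrow> poly_family (\<lambda>x. F x + G x) (\<lambda>n. c n + e n)"
  by (simp add: poly_family_def germ_add)

lemma poly_family_dx: "poly_family F c \<Longrightarrow> poly_family (\<lambda>x. dx (F x)) (\<lambda>n. c (n + 1) + pderiv (c n))"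
  by (simp add: poly_family_def dx_nth germ_add fps_deriv_germ)

lemma poly_family_op_apply:
  "poly_family F c \<Longrightarrow> \<exists>e. poly_family (\<lambda>x. op_apply (op_germ x A) (F x)) e"
proof (induction A arbitrary: F c)
  case 0
  have "poly_family (\<lambda>x. 0) (\<lambda>n. 0)" by (simp add: poly_family_def)
  then show ?case by auto
next
  case (pCons f A)
  have "map_poly (germ x) (pCons f A) = pCons (germ x f) (map_poly (germ x) A)" for x
    using pCons.hyps by (simp add: map_poly_pCons)
  then show ?case
    using pCons.IH[OF poly_family_dx[OF pCons.prems]] poly_family_const_mult[OF pCons.prems, of f]
    by (auto simp: op_apply_pCons intro: poly_family_add)
qed

lemma poly_family_zser:
  assumes "poly_family F c"
  shows "\<exists>e. poly_family (\<lambda>x. zser s * F x) e"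
proof -
  obtain m where m: "\<And>i. i < m \<Longrightarrow> fls_nth s i = 0" using fls_lower_bound[of "s"] by blast
  obtain n where n: "\<And>i. i < n \<Longrightarrow> fls_nth (F 0) i = 0" using fls_lower_bound[of "F 0"] by blast
  \<comment> \<open>The bound \<open>n\<close> is found at base point 0 and then serves all base
    points, because the vanishing is one of polynomials.\<close>
  with assms have "c i = 0" if "i < n" for i
    using that by (metis germ_eq_0_iff poly_family_def)
  with assms have n: "fls_nth (F x) i = 0" if "i < n" for i x
    using that by (simp add: poly_family_def)
  have "fls_nth (zser s * F x) k = germ x (\<Sum>i=m..k-n. smult (fls_nth s i) (c (k - i)))" for x k
    using fls_times_nth_bounds[of m "zser s" n "F x" k] m n assms
    by (simp add: germ_sum germ_smult poly_family_def)
  then show ?thesis unfolding poly_family_def by (intro exI allI)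
qed

section \<open>Expansion of Laurent series in roots of a shifted variable\<close>

text \<open>Serves to identify two expansions in \<open>x\<close> by their logarithmic derivative
  and their value at \<open>x = 0\<close>.\<close>

lemma fps_linear_ode_unique:
  fixes F G H :: "'a::field_char_0 fps"
  assumes "fps_deriv F = H * F" "fps_deriv G = H * G" "fps_nth F 0 = fps_nth G 0"
  shows "F = G"
proof (rule fps_ext)
  fix n
  show "fps_nth F n = fps_nth G n"
  proof (induction n rule: less_induct)
    case (less n)
    show ?case
    proof (cases n)
      case (Suc k)
      have "fps_nth (H * F) k = fps_nth (H * G) k"
        unfolding fps_mult_nth by (intro sum.cong) (auto simp: less Suc)
      then have "of_nat (k + 1) * fps_nth F (k + 1) = of_nat (k + 1) * fps_nth G (k + 1)"
        unfolding assms(1,2)[symmetric] by simp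
      then show ?thesis by (simp add: Suc del: of_nat_Suc)
    qed (simp add: assms)
  qed
qed

locale root_expansion =
  fixes N :: nat and \<mu> :: complex
  assumes N_pos: "N > 0" and \<mu>_nz: "\<mu> \<noteq> 0"
begin

text \<open>\<open>u = x\<^sup>-\<^sup>1\<^sup>/\<^sup>N\<close> is the indeterminate, and \<open>delta\<close> is \<open>d/dx\<close>. Taylor's formula at \<open>\<zeta>\<^sup>N\<close>
  turns \<open>f\<close> into the series \<open>shift f\<close> in \<open>x\<close>; there \<open>scale\<close> puts \<open>u = 1/\<zeta>\<close>.\<close>

definition delta :: "complex fls \<Rightarrow> complex fls" where
  "delta f = fls_const (- 1 / of_nat N) * fls_X ^ (N + 1) * fls_deriv f"

definition scale :: "complex fls \<Rightarrow> complex fls" where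
  "scale f = fls_compose_fps f (fps_const \<mu> * fps_X)"

definition shift :: "complex fls \<Rightarrow> complex fls fps" where
  "shift f = Abs_fps (\<lambda>k. fls_const (1 / fact k) * scale ((delta ^^ k) f))"

lemma fls_X_mult_X_inv: "fls_X * fls_X_inv = (1 :: complex fls)"
  by (rule fls_eqI) (simp add: fls_X_inv_times_conv_shift)

lemma fls_X_power_mult_nth: "fls_nth (fls_X ^ n * f) k = fls_nth (f :: complex fls) (k - int n)"
  by (simp add: fls_X_power_times_conv_shift)

lemma delta_nth: "fls_nth (delta f) n = (of_nat N - of_int n) / of_nat N * fls_nth f (n - int N)"
proof -
  have "delta f = fls_const (- 1 / of_nat N) * (fls_X ^ (N + 1) * fls_deriv f)"
    by (simp only: delta_def mult.assoc)
  then show ?thesis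
    by (simp only: fls_mult_const_nth fls_X_power_mult_nth) (use N_pos in \<open>simp add: field_simps\<close>)
qed

lemma delta_add: "delta (f + g) = delta f + delta g"
  by (rule fls_eqI) (simp add: delta_nth algebra_simps)

lemma delta_0 [simp]: "delta 0 = 0"
  by (simp add: delta_def)

lemma delta_sum: "delta (sum F I) = (\<Sum>i\<in>I. delta (F i))"
  by (induction I rule: infinite_finite_induct) (simp_all add: delta_add)

lemma delta_mult: "delta (f * g) = f * delta g + delta f * g"
  by (simp add: delta_def fls_deriv_mult algebra_simps)

lemma delta_const [simp]: "delta (fls_const c) = 0"
  by (simp add: delta_def)

lemma scale_hom:
  "scale (f + g) = scale f + scale g" "scale (f * g) = scale f * scale g"
  "scale (fls_const c) = fls_const c" "scale 1 = 1" "scale 0 = 0"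
  using \<mu>_nz by (simp_all add: scale_def fls_compose_fps_add fls_compose_fps_mult)

lemma scale_nth: "fls_nth (scale f) n = \<mu> powi n * fls_nth f n"
  unfolding scale_def using \<mu>_nz by (subst fls_nth_fls_compose_fps_linear) (auto simp: mult.commute)

lemma shift_nth_0 [simp]: "fps_nth (shift f) 0 = scale f"
  by (simp add: shift_def)

lemma fps_deriv_shift: "fps_deriv (shift f) = shift (delta f)"
proof (rule fps_ext)
  fix k
  have "(of_nat (k + 1) :: complex fls) * fls_const (1 / fact (k + 1)) = fls_const (of_nat (k + 1) * (1 / fact (k + 1)))"
    by (simp only: fls_of_nat fls_const_mult_const)
  also have "\<dots> = fls_const (1 / fact k)"
    by (simp del: of_nat_Suc)
  finally show "fps_nth (fps_deriv (shift f)) k = fps_nth (shift (delta f)) k"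
    unfolding shift_def fps_deriv_nth fps_nth_Abs_fps mult.assoc[symmetric]
    by (simp add: funpow_swap1)
qed

lemma delta_pow_add: "(delta ^^ k) (f + g) = (delta ^^ k) f + (delta ^^ k) g"
  by (induction k) (simp_all add: delta_add)

lemma shift_add: "shift (f + g) = shift f + shift g"
  by (rule fps_ext) (simp add: shift_def delta_pow_add scale_hom algebra_simps)

lemma shift_const [simp]: "shift (fls_const c) = fps_const (fls_const c)"
proof (rule fps_ext)
  fix k
  have "(delta ^^ Suc j) (fls_const c) = 0" for j
    by (induction j) auto
  then show "fps_nth (shift (fls_const c)) k = fps_nth (fps_const (fls_const c)) k"
    by (cases k) (simp_all add: shift_def scale_hom del: funpow.simps(2))
qed

lemma shift_1 [simp]: "shift 1 = 1"
  using shift_const[of 1] by (simp del: shift_const)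

lemma shift_0 [simp]: "shift 0 = 0"
  using shift_const[of 0] by (simp del: shift_const)

text \<open>By the Leibniz rule for \<open>delta\<close>, coefficient \<open>k + 1\<close> reduces
  to coefficient \<open>k\<close> of products with differentiated factors; hence the induction over
  arbitrary \<open>f\<close> and \<open>g\<close>.\<close>

lemma shift_mult: "shift (f * g) = shift f * shift g"
proof (rule fps_ext)
  fix k
  show "fps_nth (shift (f * g)) k = fps_nth (shift f * shift g) k"
  proof (induction k arbitrary: f g)
    case (Suc k)
    have "fps_nth (fps_deriv (shift (f * g))) k = fps_nth (fps_deriv (shift f * shift g)) k"
      by (simp add: fps_deriv_shift delta_mult shift_add Suc)
    then have "of_nat (k + 1) * fps_nth (shift (f * g)) (k + 1) = of_nat (k + 1) * fps_nth (shift f * shift g) (k + 1)"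
      by (simp only: fps_deriv_nth)
    then show ?case by (simp del: of_nat_Suc)
  qed (simp add: scale_hom)
qed

lemma shift_sum: "shift (sum F I) = (\<Sum>i\<in>I. shift (F i))"
  by (induction I rule: infinite_finite_induct) (simp_all add: shift_add)

lemma zeta_nz: "zeta \<mu> \<noteq> 0"
  using \<mu>_nz by (simp add: zeta_def)

lemma zeta_power: "zeta \<mu> ^ j = fls_const (1 / \<mu> ^ j) * fls_X_inv ^ j"
  by (simp add: zeta_def power_mult_distrib fls_const_power[symmetric] power_one_over)

lemma zeta_powi: "zeta \<mu> powi (- int n) = fls_const (\<mu> ^ n) * fls_X ^ n"
proof -
  have "(fls_const (\<mu> ^ n) * fls_X ^ n) * zeta \<mu> ^ n =
      fls_const (\<mu> ^ n * (1 / \<mu> ^ n)) * (fls_X * fls_X_inv) ^ n"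
    by (simp only: zeta_power power_mult_distrib fls_const_mult_const[symmetric] mult_ac)
  also have "\<dots> = 1" using \<mu>_nz by (simp add: fls_X_mult_X_inv)
  finally have "inverse (zeta \<mu> ^ n) = fls_const (\<mu> ^ n) * fls_X ^ n"
    by (metis inverse_unique mult.commute)
  then show ?thesis by (simp add: power_int_minus)
qed

lemma scale_X_inv_power: "scale (fls_X_inv ^ j) = zeta \<mu> ^ j"
  by (rule fls_eqI) (simp add: scale_nth zeta_power power_int_minus inverse_eq_divide)

lemma delta_X_inv_power:
  "delta (fls_X_inv ^ j) = fls_const (of_nat j / of_nat N) * fls_X ^ N * fls_X_inv ^ j"
proof (rule fls_eqI)
  fix n
  have "fls_nth (fls_const (of_nat j / of_nat N :: complex) * fls_X ^ N * fls_X_inv ^ j) n =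
      of_nat j / of_nat N * fls_nth (fls_X_inv ^ j) (n - int N)"
    by (simp only: mult.assoc fls_mult_const_nth fls_X_power_mult_nth)
  then show "fls_nth (delta (fls_X_inv ^ j)) n =
      fls_nth (fls_const (of_nat j / of_nat N) * fls_X ^ N * fls_X_inv ^ j) n"
    by (cases "n = int N - int j") (auto simp: delta_nth)
qed

text \<open>\<open>fls_X_inv ^ N\<close> stands for the function \<open>x\<close>: its derivative is
  1 and its value at \<open>\<zeta>^N\<close> is \<open>\<zeta>^N\<close>.\<close>

lemma shift_X_inv_N: "shift (fls_X_inv ^ N) = fps_const (zeta \<mu> ^ N) + fps_X"
proof -
  have "fls_X ^ N * fls_X_inv ^ N = (1 :: complex fls)"
    by (simp add: power_mult_distrib[symmetric] fls_X_mult_X_inv)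
  then have "delta (fls_X_inv ^ N) = 1"
    using N_pos by (simp add: delta_X_inv_power)
  then have "fps_deriv (shift (fls_X_inv ^ N) - (fps_const (zeta \<mu> ^ N) + fps_X)) = 0"
    by (simp add: fps_deriv_shift)
  then show ?thesis
    unfolding fps_deriv_eq_0_iff by (simp add: scale_X_inv_power)
qed

lemma shift_X_N_inverse: "shift (fls_X ^ N) * (fps_const (zeta \<mu> ^ N) + fps_X) = 1"
  by (simp add: shift_X_inv_N[symmetric] shift_mult[symmetric] power_mult_distrib[symmetric]
      fls_X_mult_X_inv)

lemma shifted_power_nth_0 [simp]: "fps_nth (shifted_power N \<mu> s) 0 = 1"
  by (simp add: shifted_power_def)

text \<open>For general \<open>s\<close> the function \<open>x^(s/N)\<close> is no Laurent series in
  \<open>u\<close>, so \<open>shift\<close> does not apply to it. The equation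
  \<open>(\<zeta>^N + x) S' = (s/N) S\<close> is instead read off from the recursion of
  \<open>gchoose\<close>.\<close>

lemma fps_deriv_shifted_power:
  "fps_deriv (shifted_power N \<mu> s) = shift (fls_const (s / of_nat N) * fls_X ^ N) * shifted_power N \<mu> s"
proof -
  define \<sigma> where "\<sigma> = s / of_nat N"
  define t where "t = inverse (zeta \<mu> ^ N)"
  have powi: "zeta \<mu> powi (- int (k * N)) = t ^ k" for k
    unfolding t_def
    by (simp add: power_int_minus power_inverse power_mult[symmetric] mult.commute flip: of_nat_mult)
  have t: "zeta \<mu> ^ N * t = 1" using zeta_nz by (simp add: t_def)
  have P: "shifted_power N \<mu> s = Abs_fps (\<lambda>k. fls_const (\<sigma> gchoose k) * t ^ k)"
    by (simp only: shifted_power_def powi \<sigma>_def)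
  have "(fps_const (zeta \<mu> ^ N) + fps_X) * fps_deriv (shifted_power N \<mu> s) =
      fps_const (fls_const \<sigma>) * shifted_power N \<mu> s"
  proof (rule fps_ext)
    fix k
    have 1: "fps_nth (fps_const (zeta \<mu> ^ N) * fps_deriv (shifted_power N \<mu> s)) k =
        fls_const (of_nat (Suc k) * (\<sigma> gchoose Suc k)) * t ^ k"
    proof -
      have "fps_nth (fps_const (zeta \<mu> ^ N) * fps_deriv (shifted_power N \<mu> s)) k =
          (zeta \<mu> ^ N * t) * (of_nat (Suc k) * fls_const (\<sigma> gchoose Suc k) * t ^ k)"
        by (simp add: P mult_ac del: of_nat_Suc)
      then show ?thesis by (simp only: t fls_of_nat fls_const_mult_const mult_1)
    qed
    have 2: "fps_nth (fps_X * fps_deriv (shifted_power N \<mu> s)) k =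
        fls_const (of_nat k * (\<sigma> gchoose k)) * t ^ k"
    proof (cases k)
      case (Suc j)
      then have "fps_nth (fps_X * fps_deriv (shifted_power N \<mu> s)) k =
          of_nat k * (fls_const (\<sigma> gchoose k) * t ^ k)"
        by (simp add: P)
      then show ?thesis by (simp only: fls_of_nat fls_const_mult_const mult.assoc[symmetric])
    qed simp
    have "fps_nth ((fps_const (zeta \<mu> ^ N) + fps_X) * fps_deriv (shifted_power N \<mu> s)) k =
        fls_const (of_nat (Suc k) * (\<sigma> gchoose Suc k) + of_nat k * (\<sigma> gchoose k)) * t ^ k"
      by (simp only: distrib_right fps_add_nth 1 2 fls_plus_const[symmetric])
    also have "of_nat (Suc k) * (\<sigma> gchoose Suc k) + of_nat k * (\<sigma> gchoose k) = \<sigma> * (\<sigma> gchoose k)"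
      using gbinomial_mult_1[of \<sigma> k] by simp
    also have "fls_const (\<sigma> * (\<sigma> gchoose k)) * t ^ k = fps_nth (fps_const (fls_const \<sigma>) * shifted_power N \<mu> s) k"
      by (simp add: P mult.assoc flip: fls_const_mult_const)
    finally show "fps_nth ((fps_const (zeta \<mu> ^ N) + fps_X) * fps_deriv (shifted_power N \<mu> s)) k =
        fps_nth (fps_const (fls_const \<sigma>) * shifted_power N \<mu> s) k" .
  qed
  then have "shift (fls_X ^ N) * (fps_const (zeta \<mu> ^ N) + fps_X) * fps_deriv (shifted_power N \<mu> s) =
      shift (fls_X ^ N) * (fps_const (fls_const \<sigma>) * shifted_power N \<mu> s)"
    by (simp only: mult.assoc)
  then show ?thesis
    by (simp add: shift_X_N_inverse shift_mult \<sigma>_def mult_ac)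
qed

lemma zeta_power_shifted_power: "fps_const (zeta \<mu> ^ j) * shifted_power N \<mu> (of_nat j) = shift (fls_X_inv ^ j)"
proof (rule fps_linear_ode_unique)
  let ?H = "shift (fls_const (of_nat j / of_nat N) * fls_X ^ N)"
  show "fps_deriv (fps_const (zeta \<mu> ^ j) * shifted_power N \<mu> (of_nat j)) =
      ?H * (fps_const (zeta \<mu> ^ j) * shifted_power N \<mu> (of_nat j))"
    by (simp only: fps_deriv_mult_const_left fps_deriv_shifted_power mult.left_commute)
  show "fps_deriv (shift (fls_X_inv ^ j)) = ?H * shift (fls_X_inv ^ j)"
    by (simp only: fps_deriv_shift delta_X_inv_power shift_mult)
qed (simp add: scale_X_inv_power)

lemma at_inf_altdef: "at_inf f = (\<Sum>j\<le>degree f. fls_const (coeff f j) * fls_X_inv ^ j)"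
  by (simp add: at_inf_def poly_altdef coeff_map_poly degree_map_poly)

lemma shifted_exponent_nth_0 [simp]: "fps_nth (shifted_exponent N \<mu> Q) 0 = 0"
  by (simp add: shifted_exponent_def fps_sum_nth)

lemma fps_deriv_shifted_exponent: "fps_deriv (shifted_exponent N \<mu> Q) = shift (delta (at_inf Q))"
proof -
  have "fps_deriv (fps_const (fls_const (coeff Q j) * zeta \<mu> ^ j) * (shifted_power N \<mu> (of_nat j) - 1)) =
      fps_deriv (shift (fls_const (coeff Q j) * fls_X_inv ^ j))" for j
  proof -
    have "fps_const (fls_const (coeff Q j) * zeta \<mu> ^ j) * (shifted_power N \<mu> (of_nat j) - 1) =
        shift (fls_const (coeff Q j) * fls_X_inv ^ j) - fps_const (fls_const (coeff Q j) * zeta \<mu> ^ j)"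
      by (simp add: shift_mult zeta_power_shifted_power[symmetric] right_diff_distrib mult.assoc flip: fps_const_mult)
    then show ?thesis by simp
  qed
  then show ?thesis
    by (simp only: shifted_exponent_def fps_deriv_sum fps_deriv_shift at_inf_altdef[of Q] delta_sum shift_sum)
qed

text \<open>\<open>u^m\<close> is \<open>x^(-m/N)\<close>, and \<open>k\<close> derivatives produce
  a falling factorial times \<open>u^(m + k N)\<close>; here \<open>m = n - k N\<close>.\<close>

lemma delta_pow_nth:
  "fls_nth ((delta ^^ k) f) n =
    fact k * ((- of_int (n - int (k * N)) / of_nat N) gchoose k) * fls_nth f (n - int (k * N))"
proof (induction k arbitrary: n)
  case (Suc k)
  define \<sigma> :: complex where "\<sigma> = - of_int (n - int (Suc k * N)) / of_nat N"
  have shift: "n - int N - int (k * N) = n - int (Suc k * N)" by simp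
  have "(of_nat N - of_int n) / of_nat N = \<sigma> - (of_nat k :: complex)"
    using N_pos by (simp add: \<sigma>_def field_simps)
  then have "fls_nth ((delta ^^ Suc k) f) n =
      (\<sigma> - of_nat k) * (fact k * (\<sigma> gchoose k) * fls_nth f (n - int (Suc k * N)))"
    by (simp only: funpow.simps comp_apply delta_nth Suc shift \<sigma>_def)
  also have "(\<sigma> - of_nat k) * (\<sigma> gchoose k) = of_nat (Suc k) * (\<sigma> gchoose Suc k)"
    using gbinomial_mult_1[of \<sigma> k] by (simp add: algebra_simps)
  then have "(\<sigma> - of_nat k) * (fact k * (\<sigma> gchoose k) * fls_nth f (n - int (Suc k * N))) =
     fact (Suc k) * (\<sigma> gchoose Suc k) * fls_nth f (n - int (Suc k * N))"
    by (simp add: mult_ac)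
  finally show ?case by (simp only: \<sigma>_def)
qed simp

lemma shifted_series_eq: "shifted_series N \<mu> a = shift (fps_to_fls a)"
proof (rule fps_ext)
  fix k
  show "fps_nth (shifted_series N \<mu> a) k = fps_nth (shift (fps_to_fls a)) k"
  proof (rule fls_eqI)
    fix n
    define i where "i = n - int (k * N)"
    have lhs: "fls_nth (fps_nth (shifted_series N \<mu> a) k) n = \<mu> ^ (k * N) *
        fls_nth (fps_to_fls (Abs_fps (\<lambda>i. fps_nth a i * ((- of_nat i / of_nat N) gchoose k) * \<mu> ^ i))) i"
    proof -
      have "fps_nth (shifted_series N \<mu> a) k = fls_const (\<mu> ^ (k * N)) * (fls_X ^ (k * N) *
          fps_to_fls (Abs_fps (\<lambda>i. fps_nth a i * ((- of_nat i / of_nat N) gchoose k) * \<mu> ^ i)))"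
        by (simp only: shifted_series_def fps_nth_Abs_fps zeta_powi mult_ac)
      then show ?thesis by (simp only: fls_mult_const_nth fls_X_power_mult_nth i_def)
    qed
    have rhs: "fls_nth (fps_nth (shift (fps_to_fls a)) k) n =
        \<mu> powi n * (((- of_int i / of_nat N) gchoose k) * fls_nth (fps_to_fls a) i)"
      unfolding shift_def fps_nth_Abs_fps fls_mult_const_nth scale_nth delta_pow_nth i_def by simp
    show "fls_nth (fps_nth (shifted_series N \<mu> a) k) n = fls_nth (fps_nth (shift (fps_to_fls a)) k) n"
    proof (cases "i < 0")
      case False
      then have "n = int (k * N + nat i)" by (simp add: i_def)
      then have "\<mu> powi n = \<mu> ^ (k * N) * \<mu> ^ nat i"
        by (simp only: power_int_of_nat power_add)
      with False show ?thesis
        unfolding lhs rhs by (simp add: mult_ac)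
    qed (simp add: lhs rhs)
  qed
qed

text \<open>If \<open>S\<close> represents the formal function \<open>t\<^sup>d e\<^sup>Q\<^sup>(\<^sup>t\<^sup>) S\<close> of \<open>t = x\<^sup>1\<^sup>/\<^sup>N\<close>, then \<open>twist d Q S\<close> is its
  expansion at \<open>\<zeta>\<^sup>N + x\<close>, divided by \<open>\<zeta>\<^sup>d e\<^sup>Q\<^sup>(\<^sup>\<zeta>\<^sup>)\<close>.\<close>

definition twist :: "complex \<Rightarrow> complex poly \<Rightarrow> complex fls \<Rightarrow> complex fls fps" where
  "twist d Q S = shifted_power N \<mu> d * (fps_exp 1 oo shifted_exponent N \<mu> Q) * shift S"

lemma airy_psi_eq: "airy_psi N \<mu> d Q a = twist d Q (fps_to_fls a)"
  by (simp only: airy_psi_def twist_def shifted_series_eq)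

lemma X2_deriv_at_inf: "fls_X ^ 2 * fls_deriv (at_inf Q) = - at_inf (pderiv Q)"
proof (rule fls_eqI)
  fix n
  show "fls_nth (fls_X ^ 2 * fls_deriv (at_inf Q)) n = fls_nth (- at_inf (pderiv Q)) n"
  proof (cases "n \<le> 0")
    case True
    then have "nat (1 - n) = Suc (nat (- n))" "of_int n = - (of_nat (nat (- n)) :: complex)"
      by (auto simp: of_nat_nat)
    with True show ?thesis
      by (simp only: fls_X_power_mult_nth) (simp add: at_inf_nth coeff_pderiv algebra_simps)
  next
    case False
    then show ?thesis
      by (simp only: fls_X_power_mult_nth) (simp add: at_inf_nth)
  qed
qed

text \<open>Conjugation of \<open>delta\<close> by \<open>t^d e^Q(t)\<close> adds its logarithmic
  derivative, where \<open>log t^d\<close> contributes \<open>(d/N) u^N\<close>.\<close>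

lemma root_deriv_eq: "root_deriv N d Q S =
    delta S + (delta (at_inf Q) + fls_const (d / of_nat N) * fls_X ^ N) * S"
proof -
  obtain M where M: "N = Suc M" using N_pos by (cases N) auto
  have "delta f = fls_const (1 / of_nat N) * fls_X ^ (N - 1) * (- (fls_X ^ 2 * fls_deriv f))" for f
  proof -
    have "N + 1 = (N - 1) + 2" using N_pos by simp
    then have "(fls_X :: complex fls) ^ (N + 1) = fls_X ^ (N - 1) * fls_X ^ 2"
      by (simp only: power_add)
    then show ?thesis by (simp add: delta_def mult.assoc)
  qed
  moreover have "fls_const (d / of_nat N) * fls_X ^ N =
      fls_const (1 / of_nat N) * fls_X ^ (N - 1) * (fls_const d * fls_X)"
  proof -
    have "fls_const (1 / of_nat N) * fls_X ^ (N - 1) * (fls_const d * fls_X) =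
        (fls_const (1 / of_nat N) * fls_const d) * (fls_X ^ (N - 1) * fls_X)"
      by (simp only: mult_ac)
    then show ?thesis by (simp add: M mult.commute)
  qed
  ultimately show ?thesis
    by (simp only: root_deriv_def X2_deriv_at_inf) (simp add: algebra_simps)
qed

text \<open>Taylor expansion commutes with differentiation: the three factors of
  \<open>twist\<close> yield the three terms of \<open>root_deriv_eq\<close>.\<close>

lemma fps_deriv_twist: "fps_deriv (twist d Q S) = twist d Q (root_deriv N d Q S)"
proof -
  have "fps_deriv (fps_exp 1 oo shifted_exponent N \<mu> Q) =
      (fps_exp 1 oo shifted_exponent N \<mu> Q) * shift (delta (at_inf Q))"
    by (simp add: fps_compose_deriv fps_deriv_shifted_exponent)
  then show ?thesis
    by (simp add: twist_def root_deriv_eq shift_add shift_mult fps_deriv_shifted_power fps_deriv_shift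
        algebra_simps)
qed

lemma twist_mult: "twist d Q (f * S) = shift f * twist d Q S"
  by (simp add: twist_def shift_mult mult_ac)

lemma twist_add: "twist d Q (S + T) = twist d Q S + twist d Q T"
  by (simp add: twist_def shift_add algebra_simps)

lemma twist_0 [simp]: "twist d Q 0 = 0"
  by (simp add: twist_def)

lemma twist_sum: "twist d Q (sum F I) = (\<Sum>i\<in>I. twist d Q (F i))"
  by (induction I rule: infinite_finite_induct) (simp_all add: twist_add)

end

section \<open>The Airy wave function\<close>

lemma fls_X_inv_power_mult_nth: "fls_nth (fls_X_inv ^ n * f) k = fls_nth (f :: 'a::comm_ring_1 fls) (k + int n)"
proof (induction n arbitrary: k)
  case (Suc n)
  have "fls_X_inv ^ Suc n * f = fls_shift 1 (fls_X_inv ^ n * f)"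
    unfolding power_Suc mult.assoc by (rule fls_X_inv_times_conv_shift)
  with Suc show ?case by (simp add: add_ac)
qed simp

text \<open>
  In \<open>e\<^sup>-\<^sup>x\<^sup>z \<psi>\<^sub>\<alpha>\<close> the monomial \<open>x\<^sup>k z\<^sup>-\<^sup>n\<close> occurs only for \<open>k \<le> 2n\<close>: each coefficient of \<open>z\<^sup>-\<^sup>n\<close> is a
  polynomial in \<open>x\<close>. The slope 2 is attained for \<open>N = 2\<close>, by the term \<open>x\<^sup>2 z\<^sup>-\<^sup>1\<close> of the exponent.
\<close>

definition half_order :: "int \<Rightarrow> complex fls \<Rightarrow> bool" where
  "half_order m F \<longleftrightarrow> (\<forall>n. 2 * n < m \<longrightarrow> fls_nth F n = 0)"

definition half_bounded :: "complex fls fps \<Rightarrow> bool" where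
  "half_bounded F \<longleftrightarrow> (\<forall>k. half_order (int k) (fps_nth F k))"

lemma half_order_mult:
  assumes "half_order m F" "half_order n G"
  shows "half_order (m + n) (F * G)"
  unfolding half_order_def
proof (intro allI impI)
  fix k assume k: "2 * k < m + n"
  obtain p where p: "\<And>i. i < p \<Longrightarrow> fls_nth F i = 0" using fls_lower_bound[of F] by blast
  obtain q where q: "\<And>i. i < q \<Longrightarrow> fls_nth G i = 0" using fls_lower_bound[of G] by blast
  have "fls_nth (F * G) k = (\<Sum>i=p..k-q. fls_nth F i * fls_nth G (k - i))"
    by (rule fls_times_nth_bounds) (simp_all add: p q)
  also have "\<dots> = 0"
  proof (rule sum.neutral, rule ballI)
    fix i :: int
    have "2 * i < m \<or> 2 * (k - i) < n" using k by arith
    then show "fls_nth F i * fls_nth G (k - i) = 0"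
      using assms by (auto simp: half_order_def)
  qed
  finally show "fls_nth (F * G) k = 0" .
qed

lemma half_order_sum: "(\<And>i. i \<in> I \<Longrightarrow> half_order m (F i)) \<Longrightarrow> half_order m (sum F I)"
  by (auto simp: half_order_def fls_nth_sum intro!: sum.neutral)

lemma half_bounded_mult:
  assumes "half_bounded F" "half_bounded G"
  shows "half_bounded (F * G)"
  unfolding half_bounded_def fps_mult_nth
proof (intro allI half_order_sum)
  fix k i :: nat assume "i \<in> {0..k}"
  then have "int i + int (k - i) = int k" by simp
  moreover have "half_order (int i + int (k - i)) (fps_nth F i * fps_nth G (k - i))"
    using assms unfolding half_bounded_def by (intro half_order_mult) blast+
  ultimately show "half_order (int k) (fps_nth F i * fps_nth G (k - i))" by simp
qed

text \<open>In \<open>(k+1) F_(k+1) = \<Sum> H_i F_(k-i)\<close> each product has half-order at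
  least \<open>(i+1) + (k-i) = k+1\<close>.\<close>

lemma half_bounded_linear_ode:
  assumes "fps_deriv F = H * F" "half_order 0 (fps_nth F 0)"
    and "\<And>k. half_order (int k + 1) (fps_nth H k)"
  shows "half_bounded F"
  unfolding half_bounded_def
proof
  fix k
  show "half_order (int k) (fps_nth F k)"
  proof (induction k rule: less_induct)
    case (less k)
    show ?case
    proof (cases k)
      case (Suc j)
      have "half_order (int k) (fps_nth (H * F) j)"
        unfolding fps_mult_nth
      proof (rule half_order_sum)
        fix i assume "i \<in> {0..j}"
        then show "half_order (int k) (fps_nth H i * fps_nth F (j - i))"
          using half_order_mult[OF assms(3)[of i] less[of "j - i"]] by (simp add: Suc)
      qed
      then have "half_order (int k) (of_nat (j + 1) * fps_nth F (j + 1))"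
        unfolding assms(1)[symmetric] by simp
      then show ?thesis
        by (simp add: half_order_def Suc del: of_nat_Suc)
    qed (use assms in simp)
  qed
qed

lemma higher_deriv_poly: "(deriv ^^ n) (poly p) = poly ((pderiv ^^ n) (p :: complex poly))"
proof (induction n)
  case (Suc n)
  have "deriv (poly ((pderiv ^^ n) p)) = poly (pderiv ((pderiv ^^ n) p))"
    by (intro ext DERIV_imp_deriv poly_DERIV)
  with Suc show ?case by simp
qed simp

lemma fps_expansion_poly: "fps_expansion (poly p) x = germ x p"
proof (rule fps_ext)
  fix n
  have "(fps_deriv ^^ n) (germ x p) = germ x ((pderiv ^^ n) p)"
    by (induction n) (simp_all add: fps_deriv_germ)
  then have "fps_nth ((fps_deriv ^^ n) (germ x p)) 0 = poly ((pderiv ^^ n) p) x"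
    by (simp add: germ_nth_0)
  moreover have "fps_nth ((fps_deriv ^^ n) (germ x p)) 0 = fact n * fps_nth (germ x p) n"
    by (simp add: fps_0th_higher_deriv)
  ultimately show "fps_nth (fps_expansion (poly p) x) n = fps_nth (germ x p) n"
    by (simp add: fps_expansion_def higher_deriv_poly divide_eq_eq mult.commute)
qed

locale airy = airy_weyl +
  fixes \<mu> d :: complex and Q :: "complex poly" and a :: "complex fps"
  assumes \<mu>_power: "\<mu> ^ N = \<alpha> 0" and solution: "airy_solution N \<alpha> \<mu> d Q a"
begin

sublocale root_expansion N \<mu>
  using N_ge_2 \<alpha>_0 \<mu>_power by unfold_locales (auto simp: zero_power)

lemma Q_coeff_N1: "coeff Q (N + 1) = \<mu> * of_nat N / of_nat (N + 1)"
  using solution by (auto simp: airy_solution_def)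

lemma Q_coeff_beyond: "n > N + 1 \<Longrightarrow> coeff Q n = 0"
  using solution by (auto simp: airy_solution_def intro: coeff_eq_0)

lemma a_nth_0: "fps_nth a 0 = 1"
  using solution by (auto simp: airy_solution_def)

abbreviation D :: "complex fls \<Rightarrow> complex fls" where
  "D \<equiv> root_deriv N d Q"

lemma solution_eq:
  "(D ^^ N) (fps_to_fls a) + (\<Sum>i=2..N-1. fls_const (\<alpha> i) * (D ^^ (N - i)) (fps_to_fls a))
     - fls_const (\<alpha> 0) * fls_X_inv ^ N * fps_to_fls a = 0"
  using solution by (simp add: airy_solution_def Let_def)

text \<open>The logarithmic derivative of \<open>t^d e^Q(t)\<close> is
  \<open>\<mu> u^(-1) + coeff Q N\<close> plus terms of positive order, and \<open>delta\<close>
  raises the order by \<open>N\<close>. Up to the order where \<open>F\<close> may begin, nothing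
  else contributes.\<close>

lemma root_deriv_nth:
  assumes F: "\<And>i. i < m \<Longrightarrow> fls_nth F i = 0" and "n \<le> m"
  shows "fls_nth (D F) n = \<mu> * fls_nth F (n + 1) + coeff Q N * fls_nth F n"
proof -
  define w where "w = delta (at_inf Q) + fls_const (d / of_nat N) * fls_X ^ N"
  define w' where "w' = w - (fls_const \<mu> * fls_X_inv + fls_const (coeff Q N))"
  have N: "N \<ge> 2" by (rule N_ge_2)
  have w_nth: "fls_nth w i = (of_nat N - of_int i) / of_nat N * coeff Q (nat (int N - i))" if "i \<le> 0" for i
    using that N by (simp add: w_def delta_nth at_inf_nth)
  have w'_nth: "fls_nth w' i = 0" if "i < 1" for i
  proof -
    consider "i = 0" | "i = -1" | "i < -1" using \<open>i < 1\<close> by linarith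
    then show ?thesis
    proof cases
      case 2
      have "nat (int N + 1) = N + 1" by simp
      with 2 show ?thesis
        using Q_coeff_N1 N of_nat_neq_0[of N, where 'a=complex]
        by (simp add: w'_def w_nth) (simp add: field_simps)
    next
      case 3
      then have "N + 1 < nat (int N - i)" by simp
      then have "coeff Q (nat (int N - i)) = 0" by (rule Q_coeff_beyond)
      with 3 show ?thesis by (simp add: w'_def w_nth)
    qed (use N in \<open>simp add: w'_def w_nth\<close>)
  qed
  have "fls_nth (w' * F) n = (\<Sum>i=1..n-m. fls_nth w' i * fls_nth F (n - i))"
    by (rule fls_times_nth_bounds) (simp_all add: F w'_nth)
  then have w'F: "fls_nth (w' * F) n = 0" using \<open>n \<le> m\<close> by simp
  have "D F = delta F + (fls_const \<mu> * (fls_X_inv ^ 1 * F) + fls_const (coeff Q N) * F + w' * F)"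
    by (simp add: root_deriv_eq w'_def w_def algebra_simps)
  then have "fls_nth (D F) n = fls_nth (delta F) n + (\<mu> * fls_nth F (n + 1) + coeff Q N * fls_nth F n)"
    by (simp only: fls_plus_nth fls_mult_const_nth fls_X_inv_power_mult_nth w'F) simp
  moreover have "fls_nth (delta F) n = 0"
    using F[of "n - int N"] \<open>n \<le> m\<close> N by (simp add: delta_nth)
  ultimately show ?thesis by simp
qed

text \<open>To the first two orders each \<open>D\<close> multiplies by
  \<open>\<mu> u^(-1) + coeff Q N\<close>. The factor \<open>\<mu>\<close> in the last equation
  avoids the exponent \<open>k - 1\<close>.\<close>

lemma root_deriv_pow_nth:
  "(\<forall>n. n < - int k \<longrightarrow> fls_nth ((D ^^ k) (fps_to_fls a)) n = 0) \<and>
    fls_nth ((D ^^ k) (fps_to_fls a)) (- int k) = \<mu> ^ k \<and>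
    \<mu> * fls_nth ((D ^^ k) (fps_to_fls a)) (1 - int k) =
      \<mu> ^ Suc k * fps_nth a 1 + of_nat k * \<mu> ^ k * coeff Q N"
proof (induction k)
  case 0
  show ?case by (simp add: a_nth_0)
next
  case (Suc k)
  define F where "F = (D ^^ k) (fps_to_fls a)"
  have F: "fls_nth F n = 0" if "n < - int k" for n
    using Suc that by (simp add: F_def)
  have DF: "fls_nth (D F) n = \<mu> * fls_nth F (n + 1) + coeff Q N * fls_nth F n" if "n \<le> - int k" for n
    using F that by (rule root_deriv_nth)
  have 1: "fls_nth F (- int k) = \<mu> ^ k"
    and 2: "\<mu> * fls_nth F (1 - int k) = \<mu> ^ Suc k * fps_nth a 1 + of_nat k * \<mu> ^ k * coeff Q N"
    using Suc by (simp_all add: F_def)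
  have "fls_nth (D F) n = 0" if "n < - int (Suc k)" for n
    using that by (simp add: DF F)
  moreover have "fls_nth (D F) (- int (Suc k)) = \<mu> ^ Suc k"
    using DF[of "- int (Suc k)"] 1 by (simp add: F)
  moreover have "fls_nth (D F) (- int k) = \<mu> ^ Suc k * fps_nth a 1 + of_nat (Suc k) * \<mu> ^ k * coeff Q N"
    using DF[of "- int k"] 1 2 by (simp add: algebra_simps)
  ultimately show ?case
    by (simp add: F_def[symmetric]) (simp add: algebra_simps)
qed

text \<open>The coefficient of \<open>u\<^sup>1\<^sup>-\<^sup>N\<close> in the equation: \<open>L\<^sub>\<alpha>\<close> has no term of order \<open>N - 1\<close>.\<close>

lemma Q_coeff_N: "coeff Q N = 0"
proof -
  have "fls_nth ((D ^^ (N - i)) (fps_to_fls a)) (1 - int N) = 0" if "i \<in> {2..N-1}" for i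
    using root_deriv_pow_nth[of "N - i"] that by auto
  then have "fls_nth (\<Sum>i=2..N-1. fls_const (\<alpha> i) * (D ^^ (N - i)) (fps_to_fls a)) (1 - int N) = 0"
    by (simp add: fls_nth_sum)
  moreover have "fls_nth (fls_const (\<alpha> 0) * fls_X_inv ^ N * fps_to_fls a) (1 - int N) = \<alpha> 0 * fps_nth a 1"
    by (simp add: mult.assoc fls_X_inv_power_mult_nth)
  ultimately have "fls_nth ((D ^^ N) (fps_to_fls a)) (1 - int N) = \<alpha> 0 * fps_nth a 1"
    using arg_cong[OF solution_eq, of "\<lambda>F. fls_nth F (1 - int N)"] by simp
  then have "\<mu> ^ Suc N * fps_nth a 1 = \<mu> ^ Suc N * fps_nth a 1 + of_nat N * \<mu> ^ N * coeff Q N"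
    using root_deriv_pow_nth[of N] by (simp add: \<mu>_power mult.assoc)
  then show ?thesis using N_ge_2 \<mu>_nz by simp
qed

section \<open>Polynomiality in \<open>x\<close> and the Airy equation\<close>

definition Psi :: "complex fls fps" where
  "Psi = fps_exp (- fls_X_inv) * airy_psi N \<mu> d Q a"

text \<open>The exponential factor satisfies \<open>F' = H F\<close>, with \<open>H\<close> the
  derivative of the exponent minus \<open>z\<close>. In the \<open>x\<close>-free part of
  \<open>H\<close> the leading coefficient of \<open>Q\<close> cancels \<open>z\<close>, and
  \<open>Q_coeff_N\<close> removes the constant. For \<open>k > 0\<close> the coefficient of
  \<open>x^k\<close> has no term before \<open>z^(1 - k N)\<close>, and \<open>N \<ge> 2\<close>.
  The other two factors gain \<open>N\<close> powers of \<open>1/z\<close> per power of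
  \<open>x\<close>.\<close>

lemma half_bounded_Psi: "half_bounded Psi"
proof -
  have N: "N \<ge> 2" by (rule N_ge_2)
  define F where "F = fps_exp (- fls_X_inv) * (fps_exp 1 oo shifted_exponent N \<mu> Q)"
  define H where "H = shift (delta (at_inf Q)) - fps_const fls_X_inv"
  have "fps_deriv F = H * F"
    by (simp add: F_def H_def fps_compose_deriv fps_deriv_shifted_exponent algebra_simps
        flip: fps_const_neg)
  moreover have "half_order 0 (fps_nth F 0)"
    by (simp add: F_def half_order_def)
  moreover have "half_order (int k + 1) (fps_nth H k)" for k
    unfolding half_order_def
  proof (intro allI impI)
    fix n :: int assume n: "2 * n < int k + 1"
    show "fls_nth (fps_nth H k) n = 0"
    proof (cases "k = 0")
      case True
      then have H: "fls_nth (fps_nth H k) n =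
          \<mu> powi n * ((of_nat N - of_int n) / of_nat N * fls_nth (at_inf Q) (n - int N)) - (if n = -1 then 1 else 0)"
        by (simp add: H_def scale_nth delta_nth)
      consider "n = 0" | "n = -1" | "n < -1" using n True by linarith
      then show ?thesis
      proof cases
        case 1
        then show ?thesis using H by (simp add: at_inf_nth Q_coeff_N)
      next
        case 2
        have "nat (int N + 1) = N + 1" by simp
        with 2 show ?thesis using H N \<mu>_nz Q_coeff_N1 of_nat_neq_0[of N, where 'a=complex]
          by (simp add: at_inf_nth) (simp add: field_simps)
      next
        case 3
        then have "coeff Q (nat (int N - n)) = 0" by (intro Q_coeff_beyond) simp
        with 3 show ?thesis by (simp add: H at_inf_nth)
      qed
    next
      case False
      have "int k * 2 \<le> int k * int N" using N by (intro mult_left_mono) auto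
      moreover have "int k \<ge> 1" using False by simp
      ultimately have "n + 1 < int k * int N" using n by linarith
      then have "n - int (Suc k * N) < - int (N + 1)" by (simp add: algebra_simps)
      then have "fls_nth (at_inf Q) (n - int (Suc k * N)) = 0"
        by (auto simp: at_inf_nth intro!: Q_coeff_beyond)
      then have "fls_nth ((delta ^^ Suc k) (at_inf Q)) n = 0"
        by (simp only: delta_pow_nth mult_zero_right)
      with False show ?thesis
        by (simp add: H_def shift_def scale_nth funpow_swap1)
    qed
  qed
  ultimately have "half_bounded F" by (rule half_bounded_linear_ode)
  moreover have "half_bounded (shifted_power N \<mu> d)"
    unfolding half_bounded_def half_order_def
  proof (intro allI impI)
    fix k and n :: int assume n: "2 * n < int k"
    have "int k * 1 \<le> int k * int N" using N by (intro mult_left_mono) auto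
    with n have "n < int (k * N)" unfolding of_nat_mult by linarith
    then show "fls_nth (fps_nth (shifted_power N \<mu> d) k) n = 0"
      by (simp only: shifted_power_def fps_nth_Abs_fps zeta_powi fls_mult_const_nth fls_X_power_nth) simp
  qed
  moreover have "half_bounded (shift (fps_to_fls a))"
    unfolding half_bounded_def half_order_def
  proof (intro allI impI)
    fix k and n :: int assume n: "2 * n < int k"
    have "int k * 1 \<le> int k * int N" using N by (intro mult_left_mono) auto
    with n have "n < int (k * N)" unfolding of_nat_mult by linarith
    then show "fls_nth (fps_nth (shift (fps_to_fls a)) k) n = 0"
      by (simp add: shift_def scale_nth delta_pow_nth)
  qed
  ultimately have "half_bounded (F * shifted_power N \<mu> d * shift (fps_to_fls a))"
    by (intro half_bounded_mult)
  then show ?thesis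
    by (simp add: Psi_def F_def airy_psi_def shifted_series_eq mult_ac)
qed

definition psi_coeff :: "int \<Rightarrow> complex poly" where
  "psi_coeff n = (\<Sum>k\<le>nat (2 * n). monom (fls_nth (fps_nth Psi k) n) k)"

lemma coeff_psi_coeff: "coeff (psi_coeff n) k = fls_nth (fps_nth Psi k) n"
proof -
  have "coeff (psi_coeff n) k = (if k \<le> nat (2 * n) then fls_nth (fps_nth Psi k) n else 0)"
    by (simp add: psi_coeff_def coeff_sum)
  moreover have "fls_nth (fps_nth Psi k) n = 0" if "k > nat (2 * n)"
    using half_bounded_Psi that by (auto simp: half_bounded_def half_order_def)
  ultimately show ?thesis by auto
qed

lemma psi_coeff_neg: "n < 0 \<Longrightarrow> psi_coeff n = 0"
  using half_bounded_Psi
  by (intro poly_eqI) (auto simp: coeff_psi_coeff half_bounded_def half_order_def)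

lemma psi_coeff_0: "psi_coeff 0 = 1"
  using a_nth_0
  by (simp add: psi_coeff_def monom_0 Psi_def airy_psi_def shifted_series_eq scale_nth one_pCons)

abbreviation psi :: "complex \<Rightarrow> complex fps fls" where
  "psi \<equiv> airy_wave N \<mu> d Q a"

lemma psi_nth: "fls_nth (psi x) n = germ x (psi_coeff n)"
proof -
  have "Abs_fps (\<lambda>k. fls_nth (fps_nth Psi k) n) = fps_of_poly (psi_coeff n)" for n
    by (rule fps_ext) (simp add: coeff_psi_coeff)
  then have "fps_expansion (airy_coeff N \<mu> d Q a n) x = germ x (psi_coeff n)" for n
    by (simp add: airy_coeff_def Psi_def[symmetric] fps_expansion_poly[symmetric] eval_fps_of_poly[abs_def])
  then show ?thesis
    unfolding airy_wave_def
    by (subst nth_Abs_fls_lower_bound[of 0]) (auto simp: psi_coeff_neg)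
qed

lemma poly_family_psi: "poly_family psi psi_coeff"
  by (simp add: poly_family_def psi_nth)

lemma normalized_psi: "normalized (psi x)"
  by (simp add: normalized_def psi_nth psi_coeff_neg psi_coeff_0)

text \<open>\<open>dz\<close> is \<open>d/dx\<close> conjugated by \<open>e\<^sup>-\<^sup>x\<^sup>z\<close>, and \<open>dc\<close> its action on the coefficients of \<open>z\<^sup>-\<^sup>n\<close>.\<close>

definition dz :: "complex fls fps \<Rightarrow> complex fls fps" where
  "dz F = fps_const fls_X_inv * F + fps_deriv F"

lemma dz_pow_Psi: "(dz ^^ j) Psi = fps_exp (- fls_X_inv) * twist d Q ((D ^^ j) (fps_to_fls a))"
proof -
  have "dz (fps_exp (- fls_X_inv) * F) = fps_exp (- fls_X_inv) * fps_deriv F" for F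
    by (simp add: dz_def algebra_simps flip: fps_const_neg)
  then show ?thesis
    by (induction j) (simp_all add: Psi_def airy_psi_eq fps_deriv_twist)
qed

lemma dz_equation: "(dz ^^ N) Psi + (\<Sum>i=2..N-1. fps_const (fls_const (\<alpha> i)) * (dz ^^ (N - i)) Psi)
    - fps_const (fls_const (\<alpha> 0)) * (fps_X * Psi) = fps_const (fls_X_inv ^ N) * Psi"
proof -
  have "\<alpha> 0 \<noteq> 0" by (rule \<alpha>_0)
  \<comment> \<open>The term \<open>\<alpha> 0 * x\<close> expands at \<open>\<zeta>^N\<close> as
    \<open>\<alpha> 0 * \<zeta>^N + \<alpha> 0 * x\<close>; its first part is the eigenvalue
    \<open>z^N\<close>.\<close>
  then have "fls_const (\<alpha> 0) * zeta \<mu> ^ N = fls_X_inv ^ N"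
    by (simp add: zeta_power \<mu>_power mult.assoc[symmetric])
  then have zeta: "fps_const (fls_const (\<alpha> 0)) * fps_const (zeta \<mu> ^ N) = fps_const (fls_X_inv ^ N)"
    by simp
  have "fps_exp (- fls_X_inv) * twist d Q ((D ^^ N) (fps_to_fls a) +
      (\<Sum>i=2..N-1. fls_const (\<alpha> i) * (D ^^ (N - i)) (fps_to_fls a)) +
      fls_const (- \<alpha> 0) * fls_X_inv ^ N * fps_to_fls a) = 0"
    using solution_eq by simp
  then have "(dz ^^ N) Psi + (\<Sum>i=2..N-1. fps_const (fls_const (\<alpha> i)) * (dz ^^ (N - i)) Psi)
      - fps_const (fls_const (\<alpha> 0)) * (fps_const (zeta \<mu> ^ N) + fps_X) * Psi = 0"
    unfolding twist_add twist_sum mult.assoc twist_mult shift_const shift_X_inv_N dz_pow_Psi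
    by (simp add: Psi_def airy_psi_eq algebra_simps sum_distrib_left flip: fps_const_neg)
  then show ?thesis
    by (simp add: algebra_simps zeta[symmetric])
qed

definition dc :: "(int \<Rightarrow> complex poly) \<Rightarrow> int \<Rightarrow> complex poly" where
  "dc c n = c (n + 1) + pderiv (c n)"

text \<open>Bridge between two encodings: \<open>dz\<close> acts on power series in \<open>x\<close>
  over Laurent series in \<open>1/z\<close>, and \<open>dc\<close> on the same double series grouped
  by powers of \<open>z\<close>.\<close>

lemma coeff_dc_pow: "coeff ((dc ^^ j) psi_coeff n) k = fls_nth (fps_nth ((dz ^^ j) Psi) k) n"
proof (induction j arbitrary: n k)
  case (Suc j)
  have "fls_nth (fps_nth (fps_const fls_X_inv * (dz ^^ j) Psi) k) n =
      fls_nth (fps_nth ((dz ^^ j) Psi) k) (n + 1)"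
    by (simp add: fls_X_inv_times_conv_shift(1))
  with Suc show ?case
    by (simp add: dc_def[of "(dc ^^ j) psi_coeff"] dz_def[of "(dz ^^ j) Psi"] coeff_pderiv
        del: of_nat_Suc)
qed (simp add: coeff_psi_coeff)

lemma dx_pow_psi_nth: "fls_nth ((dx ^^ j) (psi x)) n = germ x ((dc ^^ j) psi_coeff n)"
  by (induction j arbitrary: n) (simp_all add: psi_nth dx_nth dc_def germ_add fps_deriv_germ)

lemma dc_equation: "(dc ^^ N) psi_coeff n + (\<Sum>i=2..N-1. smult (\<alpha> i) ((dc ^^ (N - i)) psi_coeff n))
    - [:0, \<alpha> 0:] * psi_coeff n = psi_coeff (n + int N)" (is "?l = ?r")
proof (rule poly_eqI)
  fix k
  have X: "coeff ([:0, \<alpha> 0:] * psi_coeff n) k = \<alpha> 0 * fls_nth (fps_nth (fps_X * Psi) k) n"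
    by (simp add: coeff_pCons coeff_psi_coeff split: nat.splits)
  have "fls_nth (fps_nth ((dz ^^ N) Psi + (\<Sum>i=2..N-1. fps_const (fls_const (\<alpha> i)) * (dz ^^ (N - i)) Psi)
      - fps_const (fls_const (\<alpha> 0)) * (fps_X * Psi)) k) n = coeff ?l k"
    by (simp only: coeff_add coeff_diff coeff_sum coeff_smult X coeff_dc_pow fps_add_nth fps_sub_nth
        fps_sum_nth fls_plus_nth fls_minus_nth fls_nth_sum fps_mult_left_const_nth fls_mult_const_nth)
  moreover have "fls_nth (fps_nth (fps_const (fls_X_inv ^ N) * Psi) k) n = coeff ?r k"
    by (simp add: fls_X_inv_power_mult_nth coeff_psi_coeff)
  ultimately show "coeff ?l k = coeff ?r k"
    by (simp only: dz_equation)
qed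

lemma L_psi: "op_apply (op_germ x L) (psi x) = zser (at_inf (monom 1 N)) * psi x"
proof (rule fls_eqI)
  fix n
  have "op_germ x L = monom 1 N + ((\<Sum>i=2..N-1. monom (fps_const (\<alpha> i)) (N - i)) - [:germ x [:0, \<alpha> 0:]:])"
    by (simp add: L_def L_low_def op_germ_add op_germ_diff op_germ_sum op_germ_monom map_poly_pCons)
  then have "fls_nth (op_apply (op_germ x L) (psi x)) n =
      germ x ((dc ^^ N) psi_coeff n + (\<Sum>i=2..N-1. smult (\<alpha> i) ((dc ^^ (N - i)) psi_coeff n))
        - [:0, \<alpha> 0:] * psi_coeff n)"
    by (simp only: op_apply_add op_apply_diff op_apply_sum op_apply_monom op_apply_const
        fls_plus_nth fls_minus_nth fls_nth_sum fls_mult_const_nth dx_pow_psi_nth psi_nth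
        germ_add germ_diff germ_sum germ_smult germ_mult) simp
  also have "\<dots> = fls_nth (psi x) (n + int N)"
    by (simp only: dc_equation psi_nth)
  also have "\<dots> = fls_nth (zser (at_inf (monom 1 N)) * psi x) n"
  proof -
    have "zser (at_inf (monom 1 N)) = fls_X_inv ^ N"
      by (rule fls_eqI) (simp add: at_inf_monom)
    then show ?thesis by (simp add: fls_X_inv_power_mult_nth)
  qed
  finally show "fls_nth (op_apply (op_germ x L) (psi x)) n =
      fls_nth (zser (at_inf (monom 1 N)) * psi x) n" .
qed

end

section \<open>Families normalized up to a polynomial factor\<close>

definition normalized_family :: "(complex \<Rightarrow> complex fps fls) \<Rightarrow> complex poly \<Rightarrow> bool" where
  "normalized_family F r \<longleftrightarrow> (\<exists>c. poly_family F c \<and> (\<forall>n<0. c n = 0) \<and> c 0 = r)"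

text \<open>Normalization up to \<open>r\<close> is a condition on polynomials, so a single base
  point decides it.\<close>

lemma normalized_familyI:
  assumes "poly_family F c" "F x = fls_const (germ x r) * G" "normalized G"
  shows "normalized_family F r"
proof -
  have "germ x (c n) = germ x r * fls_nth G n" for n
    using assms(1,2) by (metis fls_mult_const_nth poly_family_def)
  then have "germ x (c n) = germ x 0" if "n < 0" for n
    using assms(3) that by (simp add: normalized_def)
  moreover have "germ x (c 0) = germ x r"
    using \<open>\<And>n. germ x (c n) = germ x r * fls_nth G n\<close>[of 0] assms(3) by (simp add: normalized_def)
  ultimately show ?thesis
    using assms(1) unfolding normalized_family_def germ_eq_iff by blast
qed

lemma normalized_family_wave_function:
  assumes "normalized_family F r" "poly r x \<noteq> 0"
  shows "wave_function (fls_const (inverse (germ x r)) * F x)"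
proof -
  obtain c where c: "poly_family F c" "\<And>n. n < 0 \<Longrightarrow> c n = 0" "c 0 = r"
    using assms(1) by (auto simp: normalized_family_def)
  have nz: "fps_nth (germ x r) 0 \<noteq> 0" using assms(2) by (simp add: germ_nth_0)
  have "fps_conv_radius (inverse (germ x r)) > 0"
    using nz by (intro fps_conv_radius_inverse_pos) simp_all
  then have "fps_conv_radius (inverse (germ x r) * germ x (c n)) > 0" for n
    by (intro less_le_trans[OF _ fps_conv_radius_mult]) simp
  moreover have "inverse (germ x r) * germ x r = 1"
    using nz by (rule inverse_mult_eq_1)
  ultimately show ?thesis
    using c by (simp add: wave_function_def normalized_def poly_family_def)
qed

text \<open>The hypothesis is \<open>F/r = G/s\<close> without denominators; its coefficients are
  compared at base point 0 and \<open>s\<close> is cancelled.\<close>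

lemma normalized_family_cross:
  assumes "normalized_family G s" "poly_family F c" "s \<noteq> 0"
    and "\<And>x. fls_const (germ x s) * F x = fls_const (germ x r) * G x"
  shows "normalized_family F r"
proof -
  obtain e where e: "poly_family G e" "\<And>n. n < 0 \<Longrightarrow> e n = 0" "e 0 = s"
    using assms(1) by (auto simp: normalized_family_def)
  have "germ 0 (s * c n) = germ 0 (r * e n)" for n
    using arg_cong[OF assms(4)[of 0], of "\<lambda>F. fls_nth F n"] assms(2) e(1)
    by (simp add: poly_family_def germ_mult)
  then have "s * c n = r * e n" for n
    by (simp only: germ_eq_iff)
  with e assms(3) have "c n = 0" if "n < 0" for n
    using that by (metis mult_eq_0_iff)
  moreover have "c 0 = r"
    using \<open>\<And>n. s * c n = r * e n\<close>[of 0] e(3) assms(3) by (simp add: mult.commute)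
  ultimately show ?thesis
    using assms(2) unfolding normalized_family_def by blast
qed

lemma pcompose_linear_eq_0_iff: "k \<noteq> 0 \<Longrightarrow> f \<circ>\<^sub>p [:0, k:] = 0 \<longleftrightarrow> f = (0 :: complex poly)"
  using pcompose_eq_0[of f "[:0, k:]"] by auto

lemma pcompose_monom_eq_0_iff: "k \<noteq> 0 \<Longrightarrow> n > 0 \<Longrightarrow> f \<circ>\<^sub>p monom k n = 0 \<longleftrightarrow> f = (0 :: complex poly)"
  using pcompose_eq_0[of f "monom k n"] by (auto simp: degree_monom_eq)

lemma pcompose_linear_monom: "[:0, k:] \<circ>\<^sub>p monom l n = monom (k * l :: complex) n"
  by (simp add: pcompose_pCons smult_monom)

lemma exists_nonroot: "(r :: complex poly) \<noteq> 0 \<Longrightarrow> \<exists>x. poly r x \<noteq> 0"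
  using poly_all_0_iff_0[of r] by blast

section \<open>Spectral action on the Airy wave function\<close>

context airy
begin

definition z_series :: "complex poly \<Rightarrow> complex fps fls" where
  "z_series f = zser (at_inf (f \<circ>\<^sub>p monom 1 N))"

definition z_inverse :: "complex poly \<Rightarrow> complex fps fls" where
  "z_inverse f = zser (1 / at_inf (f \<circ>\<^sub>p monom 1 N))"

text \<open>The changes of argument that accompany \<open>b\<close>: \<open>f(X)\<close> acts on
  \<open>psi\<close> as \<open>dual_arg f\<close> at \<open>z^N\<close>, and \<open>b\<close> turns
  \<open>f(L)\<close> into multiplication by \<open>scaled_arg f\<close>.\<close>

definition dual_arg :: "complex poly \<Rightarrow> complex poly" where
  "dual_arg f = f \<circ>\<^sub>p [:0, 1 / \<alpha> 0:]"

definition scaled_arg :: "complex poly \<Rightarrow> complex poly" where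
  "scaled_arg f = f \<circ>\<^sub>p [:0, \<alpha> 0:]"

lemma dual_scaled [simp]: "dual_arg (scaled_arg f) = f" "scaled_arg (dual_arg f) = f"
  using \<alpha>_0 by (simp_all add: dual_arg_def scaled_arg_def pcompose_assoc[symmetric] pcompose_pCons)

lemma scaled_arg_smult: "scaled_arg (smult c f) = smult c (scaled_arg f)"
  by (simp add: scaled_arg_def pcompose_smult)

lemma poly_scaled_arg: "poly (scaled_arg f) x = poly f (\<alpha> 0 * x)"
  by (simp add: scaled_arg_def poly_pcompose mult.commute)

lemma scaled_arg_eq_0_iff [simp]: "scaled_arg f = 0 \<longleftrightarrow> f = 0"
  using \<alpha>_0 by (simp add: scaled_arg_def pcompose_linear_eq_0_iff)

lemma dual_arg_eq_0_iff [simp]: "dual_arg f = 0 \<longleftrightarrow> f = 0"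
  using \<alpha>_0 by (simp add: dual_arg_def pcompose_linear_eq_0_iff)

lemma dual_arg_monom: "dual_arg f \<circ>\<^sub>p monom 1 N = f \<circ>\<^sub>p monom (1 / \<alpha> 0) N"
  by (simp add: dual_arg_def pcompose_assoc[symmetric] pcompose_linear_monom)

lemma monom_arg_eq_0_iff [simp]: "(f :: complex poly) \<circ>\<^sub>p monom 1 N = 0 \<longleftrightarrow> f = 0"
  using pcompose_monom_eq_0_iff[of 1 N f] N_ge_2 by simp

lemma z_series_pCons: "z_series (pCons c f) = fls_const (fps_const c) + zser (at_inf (monom 1 N)) * z_series f"
  by (simp add: z_series_def pcompose_pCons at_inf_add at_inf_mult zser_add zser_mult zser_const)

lemma z_series_inverse: "f \<noteq> 0 \<Longrightarrow> z_series f * z_inverse f = 1"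
  by (simp add: z_series_def z_inverse_def zser_mult[symmetric])

lemma z_inverse_smult: "c \<noteq> 0 \<Longrightarrow> z_inverse (smult c f) = fls_const (fps_const (1 / c)) * z_inverse f"
proof -
  assume c: "c \<noteq> 0"
  have "1 / (fls_const c * at_inf (f \<circ>\<^sub>p monom 1 N)) = fls_const (1 / c) * (1 / at_inf (f \<circ>\<^sub>p monom 1 N))"
    using c by (simp add: fls_const_divide_const[symmetric])
  then show ?thesis
    by (simp only: z_inverse_def pcompose_smult at_inf_smult zser_mult zser_const)
qed

lemma psi_nz: "psi x \<noteq> 0"
  using normalized_psi[of x] by (auto simp: normalized_def)

lemma op_apply_psi_inj: "op_apply A (psi x) = op_apply B (psi x) \<longleftrightarrow> A = B"
  using op_apply_eq_0_iff[OF normalized_psi, of "A - B" x] by (simp add: op_apply_diff)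

lemma op_apply_germ_ocomp:
  "op_apply (op_germ x (A \<odot> B)) F = op_apply (op_germ x A) (op_apply (op_germ x B) F)"
  by (simp add: op_germ_ocomp op_apply_ocomp)

lemma oeval_L_psi: "op_apply (op_germ x (oeval c L)) (psi x) = z_series c * psi x"
proof (induction c)
  case (pCons c f)
  have "op_apply (op_germ x L) (z_series f * psi x) = z_series f * (zser (at_inf (monom 1 N)) * psi x)"
    by (simp add: z_series_def op_apply_zser L_psi)
  then show ?case
    by (simp add: oeval_pCons op_germ_add op_apply_add op_apply_germ_ocomp pCons z_series_pCons
        map_poly_pCons algebra_simps)
qed (simp add: z_series_def)

lemma oeval_X_psi: "op_apply (op_germ x (oeval c X)) (psi x) = z_series (dual_arg c) * psi x"
  by (simp add: X_def oeval_smult_right oeval_L_psi dual_arg_def)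

text \<open>Series in \<open>z\<close> commute with operators, so \<open>A L\<close> and
  \<open>L A\<close> agree on \<open>psi\<close> and are therefore equal.\<close>

lemma eigenfunction_imp:
  assumes "op_apply A (psi x) = zser s * psi x"
  obtains c where "A = op_germ x (oeval c L)"
proof -
  have "op_apply (ocomp fps_deriv A (op_germ x L)) (psi x) = op_apply (ocomp fps_deriv (op_germ x L) A) (psi x)"
    by (simp add: op_apply_ocomp L_psi op_apply_zser assms mult.left_commute)
  then have "ocomp fps_deriv A (op_germ x L) = ocomp fps_deriv (op_germ x L) A"
    by (simp only: op_apply_psi_inj)
  then show ?thesis using that by (rule commutant_of_L)
qed

lemma airy_op_eq: "airy_op N \<alpha> x = op_germ x L"
proof -
  have "op_germ x [:[:0, \<alpha> 0:]:] = [:germ x [:0, \<alpha> 0:]:]"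
    by (simp add: map_poly_pCons)
  then show ?thesis
    by (simp only: airy_op_def L_def L_low_def op_germ_add op_germ_diff op_germ_sum op_germ_monom
        germ_const germ_1 add_diff_eq)
qed

theorem spectral_algebra_airy: "spectral_algebra (psi x) = op_algebra (airy_op N \<alpha> x)"
proof -
  have "op_algebra (airy_op N \<alpha> x) = range (\<lambda>c. op_germ x (oeval c L))"
    by (simp only: op_algebra_def airy_op_eq op_germ_oeval)
  also have "\<dots> = spectral_algebra (psi x)"
  proof (intro equalityI subsetI)
    fix A assume "A \<in> range (\<lambda>c. op_germ x (oeval c L))"
    then obtain c where "A = op_germ x (oeval c L)" ..
    then show "A \<in> spectral_algebra (psi x)"
      unfolding spectral_algebra_def
      by (auto intro!: exI[of _ "c \<circ>\<^sub>p monom 1 N"] simp: analytic_op_germ oeval_L_psi[unfolded z_series_def])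
  next
    fix A assume "A \<in> spectral_algebra (psi x)"
    then obtain f where "op_apply A (psi x) = zser (at_inf f) * psi x"
      by (auto simp: spectral_algebra_def)
    then obtain c where "A = op_germ x (oeval c L)" by (rule eigenfunction_imp)
    then show "A \<in> range (\<lambda>c. op_germ x (oeval c L))" by (rule range_eqI)
  qed
  finally show ?thesis ..
qed

text \<open>In \<open>\<partial>^j p_j(X)\<close> the factor \<open>p_j(X)\<close> acts first and
  becomes the scalar \<open>p_j(z^N / \<alpha> 0)\<close>, which passes through
  \<open>\<partial>^j\<close>. Up to denominators this is the sum in \<open>b1_wave\<close>.\<close>

lemma b_psi:
  "op_apply (op_germ x (b P)) (psi x) =
    (\<Sum>j\<le>degree P. zser (at_inf (coeff P j \<circ>\<^sub>p monom (1 / \<alpha> 0) N)) * (dx ^^ j) (psi x))"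
proof -
  have 1: "op_apply (op_germ x ((dcomp pderiv ^^ j) A)) F = (dx ^^ j) (op_apply (op_germ x A) F)" for j A F
    by (induction j) (simp_all add: op_germ_dcomp op_apply_dcomp)
  have 2: "(dx ^^ j) (zser s * F) = zser s * (dx ^^ j) F" for j s F
    by (induction j) (simp_all add: dx_zser_mult)
  show ?thesis
    by (simp add: b_def op_germ_sum op_apply_sum 1 oeval_X_psi z_series_def 2 dual_arg_monom)
qed

text \<open>\<open>b1_wave\<close> without the factor \<open>1/g1(\<alpha> 0 * x)\<close>: its
  coefficients are polynomials in \<open>x\<close>, so it lives at all base points.\<close>

definition dual_family :: "complex poly poly \<Rightarrow> complex poly \<Rightarrow> complex \<Rightarrow> complex fps fls" where
  "dual_family p q x = z_inverse (dual_arg q) * op_apply (op_germ x (b p)) (psi x)"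

lemma b1_wave_eq:
  "b1_wave N \<alpha> \<mu> d Q a p q g1 x = fls_const (inverse (germ x (scaled_arg g1))) * dual_family p q x"
proof -
  have "zser (at_inf f / B) = zser (1 / B) * zser (at_inf f)" for f B
    by (simp add: zser_mult[symmetric])
  then show ?thesis
    by (simp add: b1_wave_def Let_def dual_family_def b_psi z_inverse_def dual_arg_monom scaled_arg_def
        sum_distrib_left mult.assoc)
qed

lemma poly_family_dual: "\<exists>c. poly_family (dual_family p q) c"
proof -
  obtain c where "poly_family (\<lambda>x. op_apply (op_germ x (b p)) (psi x)) c"
    using poly_family_op_apply[OF poly_family_psi] by blast
  then show ?thesis
    using poly_family_zser[of _ c "1 / at_inf (dual_arg q \<circ>\<^sub>p monom 1 N)"]
    by (simp add: dual_family_def[abs_def] z_inverse_def)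
qed

section \<open>Darboux representations and their duals\<close>

lemma airy_darbouxE:
  assumes "airy_darboux N \<mu> d Q a p q g1 x W"
  obtains P where "wave_function W" "q \<noteq> 0" "g1 \<noteq> 0" "op_germ x p = smult (germ x q) P"
    "W = z_inverse g1 * op_apply P (psi x)" "darboux_via (g1 \<circ>\<^sub>p monom 1 N) P (psi x) W"
    "fls_const (germ x q) * W = z_inverse g1 * op_apply (op_germ x p) (psi x)"
proof -
  obtain P where P: "wave_function W" "rational_op_germ x p q P" "darboux_via (g1 \<circ>\<^sub>p monom 1 N) P (psi x) W"
    using assms by (auto simp: airy_darboux_def)
  have p: "op_germ x p = smult (germ x q) P"
    by (rule poly_eqI) (use P(2) in \<open>simp add: rational_op_germ_def coeff_map_poly mult.commute\<close>)
  have W: "W = z_inverse g1 * op_apply P (psi x)"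
    using P(3) by (simp add: darboux_via_def z_inverse_def)
  have "g1 \<noteq> 0" using P(3) by (auto simp: darboux_via_def)
  moreover have "q \<noteq> 0" using P(2) by (simp add: rational_op_germ_def)
  moreover have "fls_const (germ x q) * W = z_inverse g1 * op_apply (op_germ x p) (psi x)"
    unfolding p by (subst W) (simp only: op_apply_smult mult.left_commute)
  ultimately show ?thesis using that[OF P(1) _ _ p W P(3)] by simp
qed

lemma op_apply_z_series: "op_apply A (z_series f * F) = z_series f * op_apply A F"
  by (simp add: z_series_def op_apply_zser)

text \<open>Membership in \<open>Gr_A\<close> normalizes the dual of some representation of
  \<open>W\<close>, so the dual must not depend on the choice. Comparing both representations on
  \<open>psi\<close> gives an identity of operators, to which \<open>b\<close> applies.\<close>

lemma two_representations:
  assumes "airy_darboux N \<mu> d Q a p q g1 x0 W" "airy_darboux N \<mu> d Q a p' q' g1' x0 W"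
  shows "fls_const (germ x (scaled_arg g1')) * dual_family p q x =
    fls_const (germ x (scaled_arg g1)) * dual_family p' q' x"
proof -
  from assms(1) obtain P where 1: "g1 \<noteq> 0" "q \<noteq> 0"
    "fls_const (germ x0 q) * W = z_inverse g1 * op_apply (op_germ x0 p) (psi x0)"
    by (rule airy_darbouxE) blast
  from assms(2) obtain P' where 2: "g1' \<noteq> 0" "q' \<noteq> 0"
    "fls_const (germ x0 q') * W = z_inverse g1' * op_apply (op_germ x0 p') (psi x0)"
    by (rule airy_darbouxE) blast
  have p_psi: "op_apply (op_germ x0 p) (psi x0) = z_series g1 * (fls_const (germ x0 q) * W)"
    unfolding 1(3) mult.assoc[symmetric] z_series_inverse[OF 1(1)] by simp
  have p'_psi: "op_apply (op_germ x0 p') (psi x0) = z_series g1' * (fls_const (germ x0 q') * W)"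
    unfolding 2(3) mult.assoc[symmetric] z_series_inverse[OF 2(1)] by simp
  \<comment> \<open>Both sides equal \<open>q q' g1(z^N) g1'(z^N) W\<close>.\<close>
  have "op_apply (op_germ x0 (smult q' p \<odot> oeval g1' L)) (psi x0) =
      op_apply (op_germ x0 (smult q p' \<odot> oeval g1 L)) (psi x0)"
    unfolding op_apply_germ_ocomp oeval_L_psi op_germ_smult op_apply_smult op_apply_z_series p_psi p'_psi
    by (simp only: mult_ac)
  then have "smult q' p \<odot> oeval g1' L = smult q p' \<odot> oeval g1 L"
    by (simp only: op_apply_psi_inj op_germ_eq_iff)
  from arg_cong[OF this, of b] have "smult (scaled_arg g1') (b p \<odot> oeval q' X) = smult (scaled_arg g1) (b p' \<odot> oeval q X)"
    by (simp add: b_ocomp b_smult b_oeval b_L oeval_function scaled_arg_def)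
  from arg_cong[OF this, of "\<lambda>A. op_apply (op_germ x A) (psi x)"]
  have eq: "fls_const (germ x (scaled_arg g1')) * (z_series (dual_arg q') * op_apply (op_germ x (b p)) (psi x)) =
      fls_const (germ x (scaled_arg g1)) * (z_series (dual_arg q) * op_apply (op_germ x (b p')) (psi x))"
    by (simp only: op_germ_smult op_apply_smult op_apply_germ_ocomp oeval_X_psi op_apply_z_series)
  have q: "z_series (dual_arg q) * z_inverse (dual_arg q) = 1"
    and q': "z_series (dual_arg q') * z_inverse (dual_arg q') = 1"
    using 1 2 by (simp_all add: z_series_inverse)
  have "fls_const (germ x (scaled_arg g1')) * dual_family p q x =
      (z_series (dual_arg q') * z_inverse (dual_arg q')) *
        (fls_const (germ x (scaled_arg g1')) * dual_family p q x)"
    by (simp only: q' mult_1)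
  also have "\<dots> = z_inverse (dual_arg q) * z_inverse (dual_arg q') *
      (fls_const (germ x (scaled_arg g1')) * (z_series (dual_arg q') * op_apply (op_germ x (b p)) (psi x)))"
    by (simp only: dual_family_def mult_ac)
  also have "\<dots> = (z_series (dual_arg q) * z_inverse (dual_arg q)) *
        (fls_const (germ x (scaled_arg g1)) * dual_family p' q' x)"
    unfolding eq by (simp only: dual_family_def mult_ac)
  also have "\<dots> = fls_const (germ x (scaled_arg g1)) * dual_family p' q' x"
    by (simp only: q mult_1)
  finally show ?thesis .
qed

text \<open>One non-root of \<open>g1'\<close> normalizes the whole family of \<open>p'\<close> and
  \<open>q'\<close>, and \<open>two_representations\<close> carries this over to \<open>p\<close>
  and \<open>q\<close>.\<close>

lemma normalized_dual_family:
  assumes W: "airy_darboux N \<mu> d Q a p q g1 x0 W" and Gr: "W \<in> Gr_A N \<alpha> \<mu> d Q a x0"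
  shows "normalized_family (dual_family p q) (scaled_arg g1)"
proof -
  obtain p' q' g1' where W': "airy_darboux N \<mu> d Q a p' q' g1' x0 W"
    and norm: "\<And>x1. poly g1' (\<alpha> 0 * x1) \<noteq> 0 \<Longrightarrow> normalized (b1_wave N \<alpha> \<mu> d Q a p' q' g1' x1)"
    using Gr unfolding Gr_A_def by blast
  from W' have g1': "g1' \<noteq> 0" by (rule airy_darbouxE)
  then obtain x1 where x1: "poly (scaled_arg g1') x1 \<noteq> 0"
    using exists_nonroot[of "scaled_arg g1'"] by auto
  obtain c' where c': "poly_family (dual_family p' q') c'" using poly_family_dual by blast
  obtain c where c: "poly_family (dual_family p q) c" using poly_family_dual by blast
  have "germ x1 (scaled_arg g1') * inverse (germ x1 (scaled_arg g1')) = 1"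
    using x1 by (intro inverse_mult_eq_1') (simp add: germ_nth_0)
  then have "dual_family p' q' x1 = fls_const (germ x1 (scaled_arg g1')) * b1_wave N \<alpha> \<mu> d Q a p' q' g1' x1"
    by (simp add: b1_wave_eq mult.assoc[symmetric])
  with c' have "normalized_family (dual_family p' q') (scaled_arg g1')"
    by (rule normalized_familyI) (use norm x1 in \<open>simp add: poly_scaled_arg\<close>)
  then show ?thesis
    by (rule normalized_family_cross[OF _ c _ two_representations[OF W W']]) (simp add: g1')
qed

text \<open>The inverse Darboux operator \<open>C\<close> satisfies \<open>C P = h(L)\<close>, but
  only with analytic coefficients. Pseudo-division of \<open>h(L)\<close> by \<open>p\<close> gives
  a polynomial quotient; its remainder is a left multiple of \<open>P\<close> of smaller order,
  hence 0.\<close>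

lemma right_factor_of_oeval:
  assumes "airy_darboux N \<mu> d Q a p q g1 x0 W"
  obtains r h B where "r \<noteq> 0" "B \<noteq> 0" "smult r (oeval h L) = B \<odot> p"
proof -
  from assms obtain P where P: "q \<noteq> 0" "g1 \<noteq> 0" "op_germ x0 p = smult (germ x0 q) P"
    "W = z_inverse g1 * op_apply P (psi x0)" "darboux_via (g1 \<circ>\<^sub>p monom 1 N) P (psi x0) W"
    by (rule airy_darbouxE) blast
  from P(5) obtain f C where C: "lead_coeff f = 1" "psi x0 = zser (1 / at_inf f) * op_apply C W"
    by (auto simp: darboux_via_def)
  have f: "f \<noteq> 0" using C(1) by auto
  have "op_apply P (psi x0) = z_series g1 * W"
    using z_series_inverse[OF P(2)] by (simp add: P(4) mult.assoc[symmetric])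
  moreover have CW: "op_apply C W = zser (at_inf f) * psi x0"
    using f by (subst C(2)) (simp add: mult.assoc[symmetric] zser_mult[symmetric])
  ultimately have CP: "op_apply (ocomp fps_deriv C P) (psi x0) = zser (at_inf (g1 \<circ>\<^sub>p monom 1 N) * at_inf f) * psi x0"
    by (simp add: op_apply_ocomp op_apply_z_series) (simp add: z_series_def zser_mult mult.assoc)
  then obtain h where h: "ocomp fps_deriv C P = op_germ x0 (oeval h L)"
    by (rule eigenfunction_imp)
  have nz: "ocomp fps_deriv C P \<noteq> 0"
  proof
    assume "ocomp fps_deriv C P = 0"
    with CP have "zser (at_inf (g1 \<circ>\<^sub>p monom 1 N) * at_inf f) * psi x0 = 0" by simp
    with P(2) f psi_nz[of x0] show False by simp
  qed
  then have "P \<noteq> 0" by auto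
  with P(1,3) have "op_germ x0 p \<noteq> op_germ x0 0" by simp
  then have p: "p \<noteq> 0" by auto
  have deg_P: "degree P = degree p"
    using arg_cong[OF P(3), of degree] P(1) by simp
  obtain k B R where div: "smult (lead_coeff p ^ k) (oeval h L) = B \<odot> p + R"
    and R: "\<And>j. j \<ge> degree p \<Longrightarrow> coeff R j = 0"
    by (rule W.ocomp_pseudo_div[OF p, of "oeval h L"]) blast
  \<comment> \<open>With \<open>q P\<close> for \<open>p\<close> and \<open>C P\<close> for
    \<open>h(L)\<close>, the division becomes \<open>E P = R\<close>.\<close>
  define E where "E = smult (germ x0 (lead_coeff p ^ k)) C - ocomp fps_deriv (op_germ x0 B) [:germ x0 q:]"
  have "ocomp fps_deriv (op_germ x0 B) (op_germ x0 p) = ocomp fps_deriv (ocomp fps_deriv (op_germ x0 B) [:germ x0 q:]) P"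
    by (simp add: P(3) F.ocomp_assoc)
  then have "ocomp fps_deriv E P = op_germ x0 R"
    using arg_cong[OF div, of "op_germ x0"]
    by (simp add: E_def F.ocomp_diff_left F.ocomp_smult_left h op_germ_add op_germ_smult op_germ_ocomp)
  moreover have "R = 0"
  proof (rule ccontr)
    assume "R \<noteq> 0"
    then have "op_germ x0 R \<noteq> op_germ x0 0" using op_germ_eq_iff by blast
    with \<open>ocomp fps_deriv E P = op_germ x0 R\<close> have "E \<noteq> 0" by auto
    with \<open>P \<noteq> 0\<close> have "degree R = degree E + degree P"
      using F.degree_ocomp[of E P] \<open>ocomp fps_deriv E P = op_germ x0 R\<close> by simp
    then have "degree p \<le> degree R" using deg_P by simp
    then have "lead_coeff R = 0" by (rule R)
    with \<open>R \<noteq> 0\<close> show False by simp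
  qed
  ultimately have eq: "smult (lead_coeff p ^ k) (oeval h L) = B \<odot> p"
    using div by simp
  have "oeval h L \<noteq> 0" using nz h by auto
  then have "smult (lead_coeff p ^ k) (oeval h L) \<noteq> 0" using p by simp
  then have "B \<noteq> 0" unfolding eq by auto
  with eq p show ?thesis
    using that[of "lead_coeff p ^ k" B h] by simp
qed

text \<open>
  From \<open>r h(L) = B p\<close> the anti-automorphism gives \<open>b(p) b(B) = h(\<alpha>\<^sub>0 x) r(X)\<close>, a left multiple of
  \<open>b(B)\<close>; the Ore condition turns this into a multiple \<open>s(X)\<close> of \<open>b(p)\<close> on the other side.
\<close>

lemma dual_right_factor:
  assumes "r \<noteq> 0" "B \<noteq> 0" "smult r (oeval h L) = B \<odot> p"
    and P: "P = smult u (op_germ x (b p))" "lead_coeff P = 1"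
  obtains s Z where "s \<noteq> 0" "analytic_op P \<Longrightarrow> analytic_op Z" "op_germ x (oeval s X) = ocomp fps_deriv Z P"
proof -
  \<comment> \<open>Dually \<open>r(X)^k b(B) = b(C) r(X)\<close>, so this product and
    \<open>P b(B)\<close> both end in \<open>r(X)\<close> and can be compared.\<close>
  obtain k C where C: "B \<odot> [:r ^ k:] = smult r C" using ore_condition by blast
  have C': "oeval (r ^ k) X \<odot> b B = b C \<odot> oeval r X"
    using arg_cong[OF C, of b] by (simp add: b_ocomp b_smult)
  have pB: "b p \<odot> b B = smult (scaled_arg h) (oeval r X)"
    using arg_cong[OF assms(3), of b]
    by (simp add: b_ocomp b_smult b_oeval b_L oeval_function scaled_arg_def)
  define Y where "Y = op_germ x (b B)"
  define T where "T = op_germ x (oeval r X)"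
  define v where "v = u * germ x (scaled_arg h)"
  have "Y \<noteq> op_germ x 0" unfolding Y_def op_germ_eq_iff using assms(2) by simp
  then have Y: "Y \<noteq> 0" by simp
  have "P \<noteq> 0" using P(2) by auto
  have PY: "ocomp fps_deriv P Y = smult v T"
    by (simp add: P(1) Y_def T_def F.ocomp_smult_left op_germ_ocomp[symmetric] pB op_germ_smult v_def)
  have "ocomp fps_deriv P Y \<noteq> 0" using \<open>P \<noteq> 0\<close> Y by (simp add: F.ocomp_eq_0_iff)
  with PY have v: "v \<noteq> 0" and T: "T \<noteq> 0" by auto
  obtain k' Z R where div: "smult (lead_coeff P ^ k') (op_germ x (oeval (r ^ k) X)) = ocomp fps_deriv Z P + R"
    and R: "\<And>j. j \<ge> degree P \<Longrightarrow> coeff R j = 0"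
    and Z: "F.over_S P \<Longrightarrow> F.over_S (op_germ x (oeval (r ^ k) X)) \<Longrightarrow> F.over_S Z"
    by (rule F.ocomp_pseudo_div[OF \<open>P \<noteq> 0\<close>, of "op_germ x (oeval (r ^ k) X)"]) blast
  have div: "op_germ x (oeval (r ^ k) X) = ocomp fps_deriv Z P + R"
    using div by (simp add: P(2))
  define E where "E = op_germ x (b C) - ocomp fps_deriv Z [:v:]"
  have "ocomp fps_deriv (op_germ x (oeval (r ^ k) X)) Y = ocomp fps_deriv (op_germ x (b C)) T"
    by (simp add: Y_def T_def op_germ_ocomp[symmetric] C')
  moreover have "ocomp fps_deriv (ocomp fps_deriv Z P) Y = ocomp fps_deriv (ocomp fps_deriv Z [:v:]) T"
    by (simp add: F.ocomp_assoc PY)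
  ultimately have RY: "ocomp fps_deriv R Y = ocomp fps_deriv E T"
    unfolding div by (simp add: E_def F.ocomp_diff_left F.ocomp_add_left algebra_simps)
  \<comment> \<open>By \<open>R Y = E T\<close> and \<open>P Y = v T\<close>, a nonzero
    \<open>R\<close> would have order at least that of \<open>P\<close>.\<close>
  have "R = 0"
  proof (rule ccontr)
    assume "R \<noteq> 0"
    with Y have "ocomp fps_deriv R Y \<noteq> 0" by (simp add: F.ocomp_eq_0_iff)
    with RY have "E \<noteq> 0" by auto
    have "degree R + degree Y = degree E + degree T"
      using RY F.degree_ocomp[OF \<open>R \<noteq> 0\<close> Y] F.degree_ocomp[OF \<open>E \<noteq> 0\<close> T] by simp
    moreover have "degree P + degree Y = degree T"
      using PY F.degree_ocomp[OF \<open>P \<noteq> 0\<close> Y] v by simp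
    ultimately have "degree R \<ge> degree P" by simp
    with R[of "degree R"] \<open>R \<noteq> 0\<close> show False by simp
  qed
  moreover have "r ^ k \<noteq> 0" using assms(1) by simp
  moreover have "analytic_op Z" if "analytic_op P"
    using Z that analytic_op_germ unfolding analytic_op_eq by blast
  ultimately show ?thesis
    using that[of "r ^ k" Z] div by simp
qed

text \<open>The top powers of \<open>z\<close> on the two sides are
  \<open>lead_coeff P * z^degree P\<close> and \<open>z^degree g\<close>. A monic \<open>P\<close>
  turns the pseudo-division in \<open>dual_right_factor\<close> into a division.\<close>

lemma lead_coeff_of_normalized:
  assumes "op_apply P (psi x) = zser (at_inf g) * B" "normalized B" "lead_coeff g = 1"
  shows "lead_coeff P = 1"
proof -
  define M where "M = degree g"
  have lhs: "n < - int (degree P) \<Longrightarrow> fls_nth (op_apply P (psi x)) n = 0"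
    "fls_nth (op_apply P (psi x)) (- int (degree P)) = lead_coeff P" for n
    using op_apply_nth_leading[OF normalized_psi order_refl] by blast+
  have "fls_nth (at_inf g) i = 0" if "i < - int M" for i
    using that by (auto simp: at_inf_nth M_def intro!: coeff_eq_0)
  then have rhs: "fls_nth (zser (at_inf g) * B) n = (\<Sum>i=- int M..n - 0. fls_nth (zser (at_inf g)) i * fls_nth B (n - i))" for n
    using assms(2) by (intro fls_times_nth_bounds) (auto simp: normalized_def)
  have rhs1: "fls_nth (zser (at_inf g) * B) (- int M) = 1"
    using assms(2,3) unfolding rhs by (simp add: at_inf_nth normalized_def M_def)
  have rhs0: "fls_nth (zser (at_inf g) * B) n = 0" if "n < - int M" for n
    using that unfolding rhs by simp
  have "P \<noteq> 0"
    using rhs1 by (auto simp flip: assms(1))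
  then have "\<not> - int (degree P) < - int M"
    using rhs0[of "- int (degree P)"] lhs(2) unfolding assms(1)[symmetric] by auto
  moreover have "\<not> - int M < - int (degree P)"
    using lhs(1)[of "- int M"] rhs1 unfolding assms(1)[symmetric] by auto
  ultimately have "degree P = M" by simp
  then show ?thesis using lhs(2) rhs1 unfolding assms(1)[symmetric] by simp
qed

theorem b1_wave_in_Gr_A:
  assumes W: "airy_darboux N \<mu> d Q a p q g1 x0 W" and Gr: "W \<in> Gr_A N \<alpha> \<mu> d Q a x0"
    and x1: "poly g1 (\<alpha> 0 * x1) \<noteq> 0"
  shows "wave_function (b1_wave N \<alpha> \<mu> d Q a p q g1 x1)"
    and "b1_wave N \<alpha> \<mu> d Q a p q g1 x1 \<in> Gr_A N \<alpha> \<mu> d Q a x1"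
proof -
  define B where "B = b1_wave N \<alpha> \<mu> d Q a p q g1 x1"
  \<comment> \<open>The dual exchanges the two denominators: \<open>q'\<close> comes from
    \<open>g1\<close>, and \<open>g'\<close> from \<open>q\<close>. The constant \<open>c\<close>
    makes \<open>g'\<close> at \<open>z^N\<close> monic.\<close>
  define c where "c = inverse (lead_coeff (dual_arg q \<circ>\<^sub>p monom 1 N))"
  define p' where "p' = smult [:c:] (b p)"
  define q' where "q' = scaled_arg g1"
  define g' where "g' = smult c (dual_arg q)"
  from W obtain P0 where q: "q \<noteq> 0" and g1: "g1 \<noteq> 0" and W_norm: "wave_function W"
    and W_eq: "fls_const (germ x0 q) * W = z_inverse g1 * op_apply (op_germ x0 p) (psi x0)"
    by (rule airy_darbouxE) blast
  have c: "c \<noteq> 0" using q by (simp add: c_def)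
  have "normalized_family (dual_family p q) (scaled_arg g1)"
    using W Gr by (rule normalized_dual_family)
  then have wave: "wave_function B"
    unfolding B_def b1_wave_eq using x1
    by (intro normalized_family_wave_function) (simp_all add: poly_scaled_arg)
  then show "wave_function (b1_wave N \<alpha> \<mu> d Q a p q g1 x1)" by (simp add: B_def)
  have q'_nz: "fps_nth (germ x1 q') 0 \<noteq> 0"
    using x1 by (simp add: germ_nth_0 q'_def poly_scaled_arg)
  define P where "P = smult (inverse (germ x1 q')) (op_germ x1 p')"
  have P_eq: "P = smult (inverse (germ x1 q') * fps_const c) (op_germ x1 (b p))"
    by (simp add: P_def p'_def op_germ_smult)
  have radius: "fps_conv_radius (inverse (germ x1 q')) > 0"
    using q'_nz by (intro fps_conv_radius_inverse_pos) simp_all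
  have analytic: "analytic_op P"
    unfolding analytic_op_eq P_def
    by (rule F.over_S_smult) (use radius analytic_op_germ in \<open>simp_all add: analytic_op_eq\<close>)
  have "inverse (germ x1 q') * germ x1 q' = 1" using q'_nz by (rule inverse_mult_eq_1)
  then have coeff_P: "coeff P j * germ x1 q' = germ x1 (coeff p' j)" for j
    by (simp add: P_def coeff_map_poly mult.commute[of _ "germ x1 q'"] mult.assoc[symmetric]
        mult.commute[of "inverse (germ x1 q')"])
  have rational: "rational_op_germ x1 p' q' P"
    using g1 analytic
    by (simp add: rational_op_germ_def q'_def[symmetric] coeff_P) (simp add: q'_def)
  have lead: "lead_coeff (g' \<circ>\<^sub>p monom 1 N) = 1"
    using q by (simp add: g'_def pcompose_smult c_def)
  then have g': "g' \<noteq> 0" by auto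
  have B_eq: "B = z_inverse g' * op_apply P (psi x1)"
  proof -
    have "z_inverse g' * op_apply P (psi x1) = fls_const (fps_const (1 / c) * fps_const c) *
        (fls_const (inverse (germ x1 q')) * dual_family p q x1)"
      using c by (simp only: g'_def z_inverse_smult[OF c] P_eq op_apply_smult dual_family_def
          fls_const_mult_const[symmetric] mult_ac)
    then show ?thesis using c by (simp add: B_def b1_wave_eq q'_def)
  qed
  have P_psi: "op_apply P (psi x1) = z_series g' * B"
    using z_series_inverse[OF g'] by (simp add: B_eq mult.assoc[symmetric])
  obtain r h C where C: "r \<noteq> 0" "C \<noteq> 0" "smult r (oeval h L) = C \<odot> p"
    using W by (rule right_factor_of_oeval)
  have lead_P: "lead_coeff P = 1"
    by (rule lead_coeff_of_normalized[OF P_psi[unfolded z_series_def] _ lead])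
      (use wave in \<open>simp add: wave_function_def\<close>)
  obtain s Z where s: "s \<noteq> 0" and Z: "analytic_op P \<Longrightarrow> analytic_op Z"
    and sZ: "op_germ x1 (oeval s X) = ocomp fps_deriv Z P"
    by (rule dual_right_factor[OF C P_eq lead_P]) blast
  define f where "f = dual_arg s \<circ>\<^sub>p monom 1 N"
  define e where "e = inverse (lead_coeff f)"
  have f: "f \<noteq> 0" using s by (simp add: f_def)
  then have e: "e \<noteq> 0" by (simp add: e_def)
  \<comment> \<open>\<open>Z\<close> takes \<open>B\<close> back to \<open>psi\<close> only up to
    \<open>1/g'(z^N)\<close>; \<open>oeval g' L\<close> clears this denominator, and
    \<open>e\<close> makes the eigenvalue \<open>f\<close> monic.\<close>
  define A where "A = smult (fps_const e) (ocomp fps_deriv (op_germ x1 (oeval g' L)) Z)"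
  have analytic_A: "analytic_op A"
    unfolding A_def analytic_op_eq
    by (intro F.over_S_smult F.over_S_ocomp)
      (use Z analytic analytic_op_germ in \<open>simp_all add: analytic_op_eq\<close>)
  have AB: "op_apply A B = zser (at_inf (smult e f)) * psi x1"
  proof -
    have "op_apply Z (op_apply P (psi x1)) = z_series (dual_arg s) * psi x1"
      by (simp add: op_apply_ocomp[symmetric] sZ[symmetric] oeval_X_psi)
    then have ZB: "op_apply Z B = z_inverse g' * (z_series (dual_arg s) * psi x1)"
      unfolding B_eq z_inverse_def by (simp add: op_apply_zser)
    have "op_apply (op_germ x1 (oeval g' L)) (op_apply Z B) =
        z_inverse g' * (z_series (dual_arg s) * (z_series g' * psi x1))"
      unfolding ZB z_inverse_def op_apply_zser op_apply_z_series oeval_L_psi ..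
    also have "\<dots> = z_series g' * z_inverse g' * (z_series (dual_arg s) * psi x1)"
      by (simp only: mult_ac)
    also have "\<dots> = zser (at_inf f) * psi x1"
      using z_series_inverse[OF g'] by (simp add: z_series_def f_def)
    finally show ?thesis
      by (simp add: A_def op_apply_smult op_apply_ocomp at_inf_smult zser_mult zser_const mult.assoc)
  qed
  have "zser (1 / at_inf (smult e f)) * zser (at_inf (smult e f)) = 1"
    using f e by (simp add: zser_mult[symmetric])
  then have psi_eq: "psi x1 = zser (1 / at_inf (smult e f)) * op_apply A B"
    unfolding AB by (simp only: mult.assoc[symmetric] mult_1)
  have "lead_coeff (smult e f) = 1" using f by (simp add: e_def)
  with analytic_A psi_eq have "darboux_via (g' \<circ>\<^sub>p monom 1 N) P (psi x1) B"
    unfolding darboux_via_def using lead analytic B_eq[unfolded z_inverse_def]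
    by (intro conjI exI[of _ "smult e f"] exI[of _ A]) assumption+
  with wave rational have darboux: "airy_darboux N \<mu> d Q a p' q' g' x1 B"
    unfolding airy_darboux_def by (intro conjI exI[of _ P]) assumption+
  have norm: "normalized (b1_wave N \<alpha> \<mu> d Q a p' q' g' x)" if "poly g' (\<alpha> 0 * x) \<noteq> 0" for x
  proof -
    \<comment> \<open>Since \<open>b (b p) = p\<close>, dualising twice returns to \<open>W\<close>:
      at \<open>x0\<close> the family is \<open>c q W\<close>, and the normalization of
      \<open>W\<close> there passes to every base point.\<close>
    have eq: "dual_family p' q' x = fls_const (germ x [:c:]) * (z_inverse g1 * op_apply (op_germ x p) (psi x))" for x
      by (simp add: dual_family_def p'_def q'_def b_smult_const op_germ_smult op_apply_smult mult.left_commute)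
    have "dual_family p' q' x0 = fls_const (germ x0 (smult c q)) * W"
      by (simp add: eq W_eq[symmetric] germ_smult mult.assoc[symmetric])
    moreover obtain e where "poly_family (dual_family p' q') e" using poly_family_dual by blast
    ultimately have "normalized_family (dual_family p' q') (smult c q)"
      using W_norm by (intro normalized_familyI) (auto simp: wave_function_def)
    moreover have "scaled_arg g' = smult c q" by (simp add: g'_def scaled_arg_smult)
    ultimately have "wave_function (b1_wave N \<alpha> \<mu> d Q a p' q' g' x)"
      unfolding b1_wave_eq using that
      by (intro normalized_family_wave_function) (simp_all add: poly_scaled_arg[symmetric])
    then show ?thesis by (simp add: wave_function_def)
  qed
  show "b1_wave N \<alpha> \<mu> d Q a p q g1 x1 \<in> Gr_A N \<alpha> \<mu> d Q a x1"
    unfolding Gr_A_def B_def[symmetric]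
    by (intro CollectI exI[of _ p'] exI[of _ q'] exI[of _ g'] conjI allI impI darboux norm)
qed

end

theorem theorem4p5:
  fixes N :: nat and \<alpha> :: "nat \<Rightarrow> complex" and \<mu> d :: complex
    and Q :: "complex poly" and a :: "complex fps"
  assumes "N \<ge> 2" and "\<alpha> 0 \<noteq> 0" and "\<mu> ^ N = \<alpha> 0"
    and "airy_solution N \<alpha> \<mu> d Q a"
  shows "(\<forall>x0. \<forall>W \<in> Gr_A N \<alpha> \<mu> d Q a x0.
            \<forall>p q g1. airy_darboux N \<mu> d Q a p q g1 x0 W \<longrightarrow>
              (\<forall>x1. poly g1 (\<alpha> 0 * x1) \<noteq> 0 \<longrightarrow>
                 wave_function (b1_wave N \<alpha> \<mu> d Q a p q g1 x1) \<and>
                 b1_wave N \<alpha> \<mu> d Q a p q g1 x1 \<in> Gr_A N \<alpha> \<mu> d Q a x1))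
       \<and> (\<forall>x0. spectral_algebra (airy_wave N \<mu> d Q a x0) = op_algebra (airy_op N \<alpha> x0))"
proof -
  interpret airy N \<alpha> \<mu> d Q a
    using assms by unfold_locales
  show ?thesis
    by (intro conjI allI ballI impI b1_wave_in_Gr_A spectral_algebra_airy)
qed

end
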